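(* In the setting described in the context, for each $0\le m\le n-2$ the pair of invariant subbundles $(W_{0,m}(Y),W_{m+1,n-1}(Y))$ is exponentially separated for the linear skew-product flow $\pi(t,x,y)=(\Phi(t,y)x,y\cdot t)$ on $\mathbb{R}^n\times Y$; that is, there exist $K>0$ and $\nu>0$ such that $$\frac{|\Phi(t,y)x_2|}{|\Phi(t,y)x_1|}\le Ke^{-\nu t},\qquad t\ge 0,$$ for all $y\in Y$, $x_1\in W_{0,m}(y)$, $x_2\in W_{m+1,n-1}(y)$ with $|x_1|=|x_2|=1$.
   Context: Let $(Y,d)$ be a compact metric space with a continuous flow $(y,t)\mapsto y\cdot t$, and $B:Y\to\mathbb{R}^{n\times n}$ continuous with each $B(y)$ tridiagonal and $b_{i,i+1}(y)>0$, $b_{i+1,i}(y)>0$ for all $y$ and $1\le i\le n-1$. Consider $\dot x=B(y\cdot t)x$ with principal fundamental matrix $\Phi(t,y)$. Let $\Lambda=\{x\in\mathbb{R}^n: x_1\ne0,\ x_n\ne0,\ \text{and if } x_i=0 \text{ for some } 2\le i\le n-1 \text{ then } x_{i-1}x_{i+1}<0\}$ and $\sigma(x)=\#\{i: x_i=0 \text{ or } x_ix_{i+1}<0\}$ for $x\in\Lambda$. For $0\le l\le m\le n-1$, $W_{l,m}(y)$ is the set of $x\ne 0$ such that the solution $x(t)$ of $\dot x=B(y\cdot t)x$, $x(0)=x$, satisfies $l\le\sigma(x(t))\le m$ whenever $x(t)\in\Lambda$, together with $0$; it is a linear subspace of dimension $m-l+1$, and $W_{l,m}(Y)=\bigcup_{y\in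 Y}W_{l,m}(y)\times\{y\}$. *)

theory Defs
  imports "HOL-Analysis.Analysis"
begin

text \<open>Coordinates of x \<in> R^n are indexed through a fixed enumeration
  e of the index type: the paper's coordinate x_{i+1} is x $ e i, for i < n,
  where n = CARD('n).\<close>

definition coord :: "(nat \<Rightarrow> 'n::finite) \<Rightarrow> real^'n \<Rightarrow> nat \<Rightarrow> real" where
  "coord e x i = x $ e i"

definition Lambda_set :: "(nat \<Rightarrow> 'n::finite) \<Rightarrow> (real^'n) set" where
  "Lambda_set e = {x. coord e x 0 \<noteq> 0 \<and> coord e x (CARD('n) - 1) \<noteq> 0 \<and>
     (\<forall>i. 1 \<le> i \<and> i \<le> CARD('n) - 2 \<longrightarrow> coord e x i = 0 \<longrightarrow>
        coord e x (i - 1) * coord e x (i + 1) < 0)}"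

definition sigma :: "(nat \<Rightarrow> 'n::finite) \<Rightarrow> real^'n \<Rightarrow> nat" where
  "sigma e x = card {i. i < CARD('n) - 1 \<and> (coord e x i = 0 \<or> coord e x i * coord e x (i + 1) < 0)}"

definition W :: "(nat \<Rightarrow> 'n::finite) \<Rightarrow> (real \<Rightarrow> 'y \<Rightarrow> real^'n^'n) \<Rightarrow> nat \<Rightarrow> nat \<Rightarrow> 'y \<Rightarrow> (real^'n) set" where
  "W e Phi l m y = {x. x \<noteq> 0 \<and> (\<forall>t. Phi t y *v x \<in> Lambda_set e \<longrightarrow>
       l \<le> sigma e (Phi t y *v x) \<and> sigma e (Phi t y *v x) \<le> m)} \<union> {0}"

end

theory Submission
  imports Defs
begin

text \<open>Let D be the closure of the set of x in Lambda with sigma x \<le> m. If a solution is nonzero at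
  time t0 and its coordinate i vanishes there, then the leading term of x_i at t0 is governed by the
  nonzero coordinates nearest to i. Hence right after t0 the solution lies in Lambda, with no more
  sign changes than any vector close to its value at t0. So Lambda-times are dense, sigma is
  nonincreasing along solutions, and the time-one map sends D minus 0 into the interior of D.
  Solutions starting in W_{0,m} stay in D, those starting in W_{m+1,n-1} never enter the interior of
  D, and by compactness both inclusions hold with a uniform angular margin. For such a pair u, v, if
  u + c v lies in D, then the margin allows c to be enlarged by a fixed factor after each unit of
  time, while v itself stays away from D; thus |v| / |u| decays exponentially.\<close>

section \<open>Sign changes of sequences\<close>

text \<open>The delicate index is the midpoint between two nonzero entries of opposite sign. Both
  reach it at the same order in t - t0 and may cancel, so its sign shortly after t0 is unknown. This
  does no harm: the signs on its two sides are forced and opposite, so the gap carries at most one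
  change whatever the midpoint does, and a zero there is of the kind that \<open>Lambda_set\<close>
  permits. A vector near the value at t0 must also change sign within that gap, hence the comparison
  of counts. D is symmetric under x to -x and in general not convex, so the contraction of a
  projective metric on a convex cone is not at hand; the estimate works with the vectors u + c v
  alone. Since -u / c lies in D and v keeps its margin from D, |u + c v| is at least c \<delta> |v|.
  The image of u + c v is the centre of a ball in D whose radius is proportional to |u + c v|, and
  this leaves room for a further multiple of the image of v, proportional to c. At the end, u / c +
  v lies in D, and the margin of v turns this into |v| \<le> |u| / (c \<delta>).\<close>

definition alternating :: "int \<Rightarrow> (int \<Rightarrow> real) \<Rightarrow> bool" where
  "alternating n v \<longleftrightarrow> v 0 \<noteq> 0 \<and> v (n - 1) \<noteq> 0 \<and>
     (\<forall>i. 0 < i \<and> i < n - 1 \<and> v i = 0 \<longrightarrow> v (i - 1) * v (i + 1) < 0)"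

text \<open>With \<open>alternating\<close>, this is the sequence form of \<open>Lambda_set\<close>
  and of the set counted by \<open>sigma\<close>. Integer indices let i - 1 leave the range on the
  left, where sequences are extended by zero.\<close>

definition changes :: "int \<Rightarrow> (int \<Rightarrow> real) \<Rightarrow> int set" where
  "changes n v = {i. 0 \<le> i \<and> i < n - 1 \<and> (v i = 0 \<or> v i * v (i + 1) < 0)}"

text \<open>For s = 1 or s = -1. The leading coefficient at index i is a combination of the two
  entries at distance d with unknown positive weights, so it has sign s for all weights exactly
  under these conditions. The case d = 0 says that u i itself has sign s.\<close>

definition nearest_sign :: "(int \<Rightarrow> real) \<Rightarrow> nat \<Rightarrow> int \<Rightarrow> real \<Rightarrow> bool" where
  "nearest_sign u d i s \<longleftrightarrow> (\<forall>j. \<bar>i - j\<bar> < int d \<longrightarrow> u j = 0) \<and>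
     0 \<le> s * u (i - int d) \<and> 0 \<le> s * u (i + int d) \<and> 0 < s * (u (i - int d) + u (i + int d))"

text \<open>Nothing is imposed at indices whose two nearest nonzero neighbours have opposite signs.\<close>

definition follows_nearest :: "int \<Rightarrow> (int \<Rightarrow> real) \<Rightarrow> (int \<Rightarrow> real) \<Rightarrow> bool" where
  "follows_nearest n u v \<longleftrightarrow>
     (\<forall>i d s. 0 \<le> i \<and> i < n \<and> s \<in> {1, -1} \<and> nearest_sign u d i s \<longrightarrow> 0 < s * v i)"

text \<open>Adjacent nonzero entries, q = p + 1, also form a gap. An index i of
  \<open>changes\<close> stands for the step from i to i + 1, so it is assigned to the gap with p
  \<le> i < q.\<close>

definition gap :: "(int \<Rightarrow> real) \<Rightarrow> int \<Rightarrow> int \<Rightarrow> bool" where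
  "gap u p q \<longleftrightarrow> p < q \<and> u p \<noteq> 0 \<and> u q \<noteq> 0 \<and> (\<forall>j. p < j \<and> j < q \<longrightarrow> u j = 0)"

lemma gap_unique:
  assumes "gap u p q" "gap u p' q'" "p \<le> i" "i < q" "p' \<le> i" "i < q'"
  shows "p = p'" "q = q'"
proof -
  have "\<not> p < p'" "\<not> p' < p" "\<not> q < q'" "\<not> q' < q"
    using assms unfolding gap_def by (meson le_less_trans less_le_trans)+
  then show "p = p'" "q = q'" by auto
qed

lemma last_nonzero_upto:
  fixes u :: "int \<Rightarrow> real"
  assumes "\<And>i. i < 0 \<Longrightarrow> u i = 0" "u k \<noteq> 0" "k \<le> i"
  obtains p where "p \<le> i" "u p \<noteq> 0" "\<And>j. p < j \<Longrightarrow> j \<le> i \<Longrightarrow> u j = 0"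
proof -
  let ?S = "{k. 0 \<le> k \<and> k \<le> i \<and> u k \<noteq> 0}"
  have f: "finite ?S" by (rule finite_subset[of _ "{0..i}"]) auto
  have "k \<in> ?S" using assms by (metis (mono_tags, lifting) mem_Collect_eq not_le)
  then have M: "Max ?S \<in> ?S" using f Max_in by blast
  show ?thesis
  proof (rule that[of "Max ?S"])
    fix j assume j: "Max ?S < j" "j \<le> i"
    show "u j = 0"
    proof (rule ccontr)
      assume "u j \<noteq> 0"
      then have "j \<in> ?S" using j M by auto
      then show False using f j Max_ge by fastforce
    qed
  qed (use M in auto)
qed

lemma first_nonzero_after:
  fixes u :: "int \<Rightarrow> real"
  assumes "\<And>i. i \<ge> n \<Longrightarrow> u i = 0" "u k \<noteq> 0" "i < k"
  obtains q where "i < q" "u q \<noteq> 0" "\<And>j. i < j \<Longrightarrow> j < q \<Longrightarrow> u j = 0"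
proof -
  let ?S = "{k. i < k \<and> k < n \<and> u k \<noteq> 0}"
  have f: "finite ?S" by (rule finite_subset[of _ "{i..n}"]) auto
  have "k \<in> ?S" using assms by (metis (mono_tags, lifting) mem_Collect_eq not_le)
  then have M: "Min ?S \<in> ?S" using f Min_in by blast
  show ?thesis
  proof (rule that[of "Min ?S"])
    fix j assume j: "j < Min ?S" "i < j"
    show "u j = 0"
    proof (rule ccontr)
      assume "u j \<noteq> 0"
      then have "j \<in> ?S" using j M by auto
      then show False using f j Min_le by fastforce
    qed
  qed (use M in auto)
qed

text \<open>A competing entry at the same distance from i would sit at the mirror image 2 * i - p of
  p. The zeros extend up to and including that index, so p alone decides the sign; for i = p the
  mirror image is p itself.\<close>

lemma follows_nearest_left:
  assumes "follows_nearest n u v" "u p \<noteq> 0" "0 \<le> i" "p \<le> i" "i < n"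
    and "\<And>j. p < j \<Longrightarrow> j \<le> 2 * i - p \<Longrightarrow> u j = 0"
  shows "0 < v i * u p"
proof -
  let ?d = "nat (i - p)"
  have "nearest_sign u ?d i (sgn (u p))"
    unfolding nearest_sign_def
  proof (intro conjI allI impI)
    show "0 \<le> sgn (u p) * u (i - int ?d)" using assms by (simp add: sgn_if)
    have *: "u (i + int ?d) = 0 \<or> u (i + int ?d) = u p"
      using assms by (cases "i = p") auto
    then show "0 \<le> sgn (u p) * u (i + int ?d)" by (auto simp add: sgn_if)
    show "0 < sgn (u p) * (u (i - int ?d) + u (i + int ?d))"
      using * assms by (auto simp add: sgn_if)
  qed (use assms in auto)
  moreover have "sgn (u p) \<in> {1, -1}" using assms by (simp add: sgn_if)
  ultimately have "0 < sgn (u p) * v i"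
    using assms unfolding follows_nearest_def by blast
  then show ?thesis using assms(2) by (auto simp: sgn_if zero_less_mult_iff split: if_splits)
qed

lemma follows_nearest_right:
  assumes "follows_nearest n u v" "u q \<noteq> 0" "0 \<le> i" "i \<le> q" "i < n"
    and "\<And>j. 2 * i - q \<le> j \<Longrightarrow> j < q \<Longrightarrow> u j = 0"
  shows "0 < v i * u q"
proof -
  let ?d = "nat (q - i)"
  have "nearest_sign u ?d i (sgn (u q))"
    unfolding nearest_sign_def
  proof (intro conjI allI impI)
    show "0 \<le> sgn (u q) * u (i + int ?d)" using assms by (simp add: sgn_if)
    have *: "u (i - int ?d) = 0 \<or> u (i - int ?d) = u q"
      using assms by (cases "i = q") auto
    then show "0 \<le> sgn (u q) * u (i - int ?d)" by (auto simp add: sgn_if)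
    show "0 < sgn (u q) * (u (i - int ?d) + u (i + int ?d))"
      using * assms by (auto simp add: sgn_if)
  qed (use assms in auto)
  moreover have "sgn (u q) \<in> {1, -1}" using assms by (simp add: sgn_if)
  ultimately have "0 < sgn (u q) * v i"
    using assms unfolding follows_nearest_def by blast
  then show ?thesis using assms(2) by (auto simp: sgn_if zero_less_mult_iff split: if_splits)
qed

text \<open>At the exact midpoint both ends contribute, and with equal signs they cannot
  cancel.\<close>

lemma follows_nearest_middle:
  assumes "follows_nearest n u v" "gap u p q" "0 < u p * u q" "0 \<le> i" "2 * i = p + q" "i < n"
  shows "0 < v i * u p"
proof -
  let ?d = "nat (i - p)"
  have pq: "p < i" "i < q" using assms unfolding gap_def by auto
  have d: "i - int ?d = p" "i + int ?d = q" using pq assms by auto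
  have "nearest_sign u ?d i (sgn (u p))"
    unfolding nearest_sign_def d
  proof (intro conjI allI impI)
    fix j assume "\<bar>i - j\<bar> < int ?d"
    then have "p < j" "j < q" using pq assms by auto
    then show "u j = 0" using assms unfolding gap_def by blast
  qed (use assms in \<open>auto simp: sgn_if zero_less_mult_iff\<close>)
  moreover have "sgn (u p) \<in> {1, -1}" using assms(3) by (auto simp add: sgn_if)
  ultimately have "0 < sgn (u p) * v i"
    using assms unfolding follows_nearest_def by blast
  then show ?thesis using assms(3) by (auto simp: sgn_if zero_less_mult_iff split: if_splits)
qed

text \<open>The signs of the two ends may agree or differ: off the midpoint the mirror image of the
  nearer end falls short of the farther end, which therefore has no influence.\<close>

lemma gap_signs:
  assumes F: "follows_nearest n u v" and g: "gap u p q" and i: "p \<le> i" "i \<le> q" "0 \<le> i" "i < n"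
  shows "2 * i < p + q \<Longrightarrow> 0 < v i * u p" "p + q < 2 * i \<Longrightarrow> 0 < v i * u q"
proof -
  show "0 < v i * u p" if "2 * i < p + q"
    by (rule follows_nearest_left[OF F]) (use that g i in \<open>auto simp: gap_def\<close>)
  show "0 < v i * u q" if "p + q < 2 * i"
    by (rule follows_nearest_right[OF F]) (use that g i in \<open>auto simp: gap_def\<close>)
qed

lemma no_sign_change_in_gap:
  assumes F: "follows_nearest n u v" and g: "gap u p q" and i: "p \<le> i" "i \<le> q" "0 \<le> i" "i < n"
    and s: "0 < u p * u q"
  shows "0 < v i * u p"
proof -
  consider "2 * i < p + q" | "2 * i = p + q" | "p + q < 2 * i" by linarith
  then show ?thesis
  proof cases
    case 1 then show ?thesis using gap_signs[OF F g i] by blast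
  next
    case 2 then show ?thesis using follows_nearest_middle[OF F g s] i by blast
  next
    case 3 then have "0 < v i * u q" using gap_signs[OF F g i] by blast
    then show ?thesis using s by (auto simp: zero_less_mult_iff)
  qed
qed

section \<open>Comparison of sign changes, gap by gap\<close>

text \<open>Before the first nonzero entry of u, after the last one, and throughout a gap with ends
  of equal sign, v is nonzero of constant sign. Only gaps with ends of opposite sign remain.\<close>

lemma change_gap:
  assumes F: "follows_nearest n u v" and supp: "\<And>i. i < 0 \<or> n \<le> i \<Longrightarrow> u i = 0" and nz: "u k \<noteq> 0"
    and i: "i \<in> changes n v"
  obtains p q where "gap u p q" "u p * u q < 0" "p \<le> i" "i < q"
proof -
  have i': "0 \<le> i" "i < n - 1" "v i = 0 \<or> v i * v (i + 1) < 0" using i by (auto simp: changes_def)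
  \<comment> \<open>If u vanished up to i, then i and i + 1 would both take the sign of the first
    nonzero entry, against the change at i.\<close>
  have "\<exists>k\<le>i. u k \<noteq> 0"
  proof (rule ccontr)
    assume n: "\<not> (\<exists>k\<le>i. u k \<noteq> 0)"
    then have "i < k" using nz by (meson not_le)
    then obtain q where q: "i < q" "u q \<noteq> 0" "\<And>j. i < j \<Longrightarrow> j < q \<Longrightarrow> u j = 0"
      using first_nonzero_after[of n u k i] supp nz by blast
    have z: "u j = 0" if "j < q" for j using n q that by (meson not_le)
    have "0 < v i * u q" "0 < v (i + 1) * u q"
      by (rule follows_nearest_right[OF F]; use q i' z in force)+
    then show False using i' by (auto simp: zero_less_mult_iff mult_less_0_iff)
  qed
  then obtain p where p: "p \<le> i" "u p \<noteq> 0" "\<And>j. p < j \<Longrightarrow> j \<le> i \<Longrightarrow> u j = 0"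
    using last_nonzero_upto[of u _ i] supp by metis
  have "\<exists>k>i. u k \<noteq> 0"
  proof (rule ccontr)
    assume n: "\<not> (\<exists>k>i. u k \<noteq> 0)"
    have z: "u j = 0" if "p < j" for j using n p that by (meson not_le)
    have "0 < v i * u p" "0 < v (i + 1) * u p"
      by (rule follows_nearest_left[OF F]; use p i' z in force)+
    then show False using i' by (auto simp: zero_less_mult_iff mult_less_0_iff)
  qed
  then obtain q where q: "i < q" "u q \<noteq> 0" "\<And>j. i < j \<Longrightarrow> j < q \<Longrightarrow> u j = 0"
    using first_nonzero_after[of n u _ i] supp by metis
  have g: "gap u p q" unfolding gap_def using p q by (meson le_less_trans not_le)
  have "\<not> 0 < u p * u q"
  proof
    assume s: "0 < u p * u q"
    have "0 < v i * u p" "0 < v (i + 1) * u p"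
      by (rule no_sign_change_in_gap[OF F g _ _ _ _ s]; use p q i' in force)+
    then show False using i' by (auto simp: zero_less_mult_iff mult_less_0_iff)
  qed
  then have "u p * u q < 0" using p q by (simp add: not_less less_le)
  then show ?thesis using that g p q by blast
qed

text \<open>Each half of the gap has a constant sign, so a change must touch the midpoint. If the
  midpoint is an index k, the candidates are k - 1 and k; a change at k - 1 gives v k the sign of
  the right half, which excludes a change at k. The two-sided bound on 2 * i isolates these
  candidates.\<close>

lemma one_change_per_gap:
  assumes F: "follows_nearest n u v" and g: "gap u p q" and s: "u p * u q < 0"
    and i: "i \<in> changes n v" "p \<le> i" "i < q" and j: "j \<in> changes n v" "p \<le> j" "j < q"
  shows "i = j"
proof -
  have *: "p + q - 2 \<le> 2 * i \<and> 2 * i \<le> p + q" if i: "i \<in> changes n v" "p \<le> i" "i < q" for i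
  proof -
    have i': "0 \<le> i" "i < n - 1" "v i = 0 \<or> v i * v (i + 1) < 0" using i by (auto simp: changes_def)
    have r: "0 \<le> i + 1" "i + 1 < n" "i < n" "p \<le> i + 1" "i + 1 \<le> q" "i \<le> q" using i' i by auto
    note a = gap_signs[OF F g \<open>p \<le> i\<close> \<open>i \<le> q\<close> \<open>0 \<le> i\<close> \<open>i < n\<close>]
    note b = gap_signs[OF F g \<open>p \<le> i + 1\<close> \<open>i + 1 \<le> q\<close> \<open>0 \<le> i + 1\<close> \<open>i + 1 < n\<close>]
    have "\<not> 2 * (i + 1) < p + q"
    proof
      assume "2 * (i + 1) < p + q"
      then show False using a(1) b(1) i' by (auto simp: zero_less_mult_iff mult_less_0_iff)
    qed
    moreover have "\<not> p + q < 2 * i"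
    proof
      assume "p + q < 2 * i"
      then show False using a(2) b(2) i' by (auto simp: zero_less_mult_iff mult_less_0_iff)
    qed
    ultimately show ?thesis by auto
  qed
  have **: False if i: "i \<in> changes n v" "p \<le> i" "i < q" and j: "j \<in> changes n v" "p \<le> j" "j < q"
    and "i < j" for i j
  proof -
    have e: "2 * j = p + q" "i = j - 1" using *[OF i] *[OF j] \<open>i < j\<close> by auto
    have b: "0 \<le> i" "j < n - 1" using i j by (auto simp: changes_def)
    have 1: "0 < v (j - 1) * u p"
      by (rule gap_signs[OF F g]) (use e i j b in auto)
    have 2: "0 < v (j + 1) * u q"
      by (rule gap_signs[OF F g]) (use e i j b in auto)
    have 3: "v (j - 1) * v j < 0" using i 1 e by (auto simp: changes_def)
    have "v j = 0 \<or> v j * v (j + 1) < 0" using j by (auto simp: changes_def)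
    then show False using 1 2 3 s by (auto simp: zero_less_mult_iff mult_less_0_iff)
  qed
  show ?thesis using **[OF i j] **[OF j i] by (cases i j rule: linorder_cases) auto
qed

lemma sign_change_between:
  fixes z :: "int \<Rightarrow> real"
  assumes "p < q" "z p * z q < 0"
  shows "\<exists>j. p \<le> j \<and> j < q \<and> (z j = 0 \<or> z j * z (j + 1) < 0)"
proof (rule ccontr)
  assume n: "\<not> ?thesis"
  have "p \<le> j \<Longrightarrow> j < q \<longrightarrow> 0 < z p * z j" for j
  proof (induction j rule: int_ge_induct)
    case base
    then show ?case using assms by (auto simp: mult_less_0_iff zero_less_mult_iff)
  next
    case (step j)
    show ?case
    proof
      assume j: "j + 1 < q"
      then have "z (j + 1) \<noteq> 0" "\<not> z j * z (j + 1) < 0" using n step by auto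
      then show "0 < z p * z (j + 1)" using step j
        by (auto simp: mult_less_0_iff zero_less_mult_iff)
    qed
  qed
  from this[of "q - 1"] have "0 < z p * z (q - 1)" using assms by simp
  moreover have "\<not> z (q - 1) * z q < 0" using n assms(1) by (auto dest: spec[of _ "q - 1"])
  ultimately show False using assms by (auto simp: mult_less_0_iff zero_less_mult_iff)
qed

lemma finite_changes [simp]: "finite (changes n v)"
  by (rule finite_subset[of _ "{0..n}"]) (auto simp: changes_def)

text \<open>An injection from the changes of v: the gap around a change has ends of opposite sign, z
  shares these signs and so changes in the same gap. Gaps do not overlap and each holds at most one
  change of v.\<close>

lemma card_changes_le:
  assumes F: "follows_nearest n u v" and supp: "\<And>i. i < 0 \<or> n \<le> i \<Longrightarrow> u i = 0" and nz: "u k \<noteq> 0"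
    and z: "\<And>i. u i \<noteq> 0 \<Longrightarrow> 0 < u i * z i"
  shows "card (changes n v) \<le> card (changes n z)"
proof -
  let ?R = "\<lambda>i j. \<exists>p q. gap u p q \<and> u p * u q < 0 \<and> p \<le> i \<and> i < q \<and> p \<le> j \<and> j < q"
  have "\<exists>j. j \<in> changes n z \<and> ?R i j" if i: "i \<in> changes n v" for i
  proof -
    obtain p q where pq: "gap u p q" "u p * u q < 0" "p \<le> i" "i < q"
      using change_gap[OF F supp nz i] by blast
    have "0 \<le> p" "q < n" using pq supp unfolding gap_def by (meson not_le)+
    moreover have "z p * z q < 0" using pq z[of p] z[of q]
      by (auto simp: gap_def mult_less_0_iff zero_less_mult_iff)
    then obtain j where "p \<le> j" "j < q" "z j = 0 \<or> z j * z (j + 1) < 0"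
      using sign_change_between[of p q z] pq by auto
    ultimately have "j \<in> changes n z" "?R i j" using pq by (auto simp: changes_def)
    then show ?thesis by blast
  qed
  then obtain g where g: "\<And>i. i \<in> changes n v \<Longrightarrow> g i \<in> changes n z \<and> ?R i (g i)" by metis
  have "inj_on g (changes n v)"
  proof (rule inj_onI)
    fix i i' assume a: "i \<in> changes n v" "i' \<in> changes n v" "g i = g i'"
    obtain p q where pq: "gap u p q" "u p * u q < 0" "p \<le> i" "i < q" "p \<le> g i" "g i < q"
      using g[OF a(1)] by blast
    obtain p' q' where pq': "gap u p' q'" "p' \<le> i'" "i' < q'" "p' \<le> g i" "g i < q'"
      using g[OF a(2)] a(3) by auto
    have "p = p'" "q = q'" using gap_unique[OF pq(1) pq'(1)] pq pq' by blast+
    then show "i = i'" using one_change_per_gap[OF F pq(1,2) a(1) _ _ a(2)] pq pq' by blast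
  qed
  then show ?thesis using g by (intro card_inj_on_le[of g]) auto
qed

text \<open>The end entries inherit the signs of the first and last nonzero entries of u. An inner
  zero of v counts as a change, so it lies in a gap with ends of opposite sign, necessarily at the
  midpoint, and its neighbours belong to different halves.\<close>

lemma follows_nearest_alternating:
  assumes F: "follows_nearest n u v" and supp: "\<And>i. i < 0 \<or> n \<le> i \<Longrightarrow> u i = 0" and nz: "u k \<noteq> 0"
  shows "alternating n v"
proof -
  have k: "0 \<le> k" "k < n" using supp nz by (meson not_le)+
  have "v 0 \<noteq> 0"
  proof -
    \<comment> \<open>The search starts at -1 so that q = 0 is allowed.\<close>
    obtain q where q: "-1 < q" "u q \<noteq> 0" "\<And>j. -1 < j \<Longrightarrow> j < q \<Longrightarrow> u j = 0"
      by (rule first_nonzero_after[of n u k "-1"]) (use supp nz k in auto)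
    have "u j = 0" if "j < q" for j using that q supp by (cases "j < 0") auto
    then have "0 < v 0 * u q"
      by (intro follows_nearest_right[OF F]) (use q k in auto)
    then show ?thesis by auto
  qed
  moreover have "v (n - 1) \<noteq> 0"
  proof -
    obtain p where p: "p \<le> n - 1" "u p \<noteq> 0" "\<And>j. p < j \<Longrightarrow> j \<le> n - 1 \<Longrightarrow> u j = 0"
      by (rule last_nonzero_upto[of u k "n - 1"]) (use supp nz k in auto)
    have "u j = 0" if "p < j" for j using that p supp by (cases "n \<le> j") auto
    then have "0 < v (n - 1) * u p"
      by (intro follows_nearest_left[OF F]) (use p k in auto)
    then show ?thesis by auto
  qed
  moreover have "v (i - 1) * v (i + 1) < 0" if i: "0 < i" "i < n - 1" "v i = 0" for i
  proof -
    have c: "i \<in> changes n v" using i by (auto simp: changes_def)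
    obtain p q where pq: "gap u p q" "u p * u q < 0" "p \<le> i" "i < q"
      using change_gap[OF F supp nz c] by blast
    \<comment> \<open>Off the midpoint \<open>gap_signs\<close> would make v i nonzero.\<close>
    have e: "2 * i = p + q" using gap_signs[OF F pq(1), of i] i pq by force
    have 1: "0 < v (i - 1) * u p"
      by (rule gap_signs[OF F pq(1)]) (use e i pq in auto)
    have 2: "0 < v (i + 1) * u q"
      by (rule gap_signs[OF F pq(1)]) (use e i pq in auto)
    show ?thesis using 1 2 pq by (auto simp: mult_less_0_iff zero_less_mult_iff)
  qed
  ultimately show ?thesis unfolding alternating_def by blast
qed

text \<open>Zeros of u sit between neighbours of opposite sign, where \<open>follows_nearest\<close>
  imposes nothing, and at nonzero entries only d = 0 applies. This makes \<open>Lambda_set\<close>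
  open and \<open>sigma\<close> locally constant on it.\<close>

lemma alternating_follows_nearest:
  assumes a: "alternating n u" and supp: "\<And>i. i < 0 \<or> n \<le> i \<Longrightarrow> u i = 0"
    and z: "\<And>i. u i \<noteq> 0 \<Longrightarrow> 0 < u i * z i"
  shows "follows_nearest n u z"
  unfolding follows_nearest_def
proof (intro allI impI)
  fix i s and d :: nat
  assume "0 \<le> i \<and> i < n \<and> s \<in> {1, - 1} \<and> nearest_sign u d i s"
  then have i: "0 \<le> i" "i < n" "s \<in> {1, - 1}" and s: "nearest_sign u d i s" by auto
  show "0 < s * z i"
  proof (cases "u i = 0")
    case True
    have b: "0 < i" "i < n - 1" using a i True
      unfolding alternating_def by (metis le_less, metis diff_add_cancel zle_add1_eq_le le_less)
    then have m: "u (i - 1) * u (i + 1) < 0" using a True unfolding alternating_def by blast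
    consider "d = 0" | "d = 1" | "d > 1" by linarith
    then show ?thesis
    proof cases
      case 1 then show ?thesis using s True by (auto simp: nearest_sign_def)
    next
      case 2 then show ?thesis using s m i(3)
        by (auto simp: nearest_sign_def mult_less_0_iff)
    next
      case 3 then have "u (i - 1) = 0" using s by (auto simp: nearest_sign_def)
      then show ?thesis using m by simp
    qed
  next
    case False
    then have "d = 0" using s unfolding nearest_sign_def by (metis abs_zero diff_self gr0I of_nat_0_less_iff)
    then have "0 < s * u i" using s unfolding nearest_sign_def by (auto simp: zero_less_mult_iff)
    then show ?thesis using z[OF False] i(3) by (auto simp: zero_less_mult_iff)
  qed
qed

section \<open>Leading order of solutions of Jacobi systems\<close>

text \<open>Replaces a Taylor expansion: the coefficients of the system are merely continuous, so
  solutions need not have higher derivatives, and the order is raised one power at a time.\<close>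

lemma lhopital_power_step:
  fixes f f' :: "real \<Rightarrow> real"
  assumes "\<And>t. (f has_real_derivative f' t) (at t)" "f t0 = 0"
    and lim: "((\<lambda>t. f' t / (t - t0) ^ k) \<longlongrightarrow> l) (at_right t0)"
  shows "((\<lambda>t. f t / (t - t0) ^ Suc k) \<longlongrightarrow> l / (real k + 1)) (at_right t0)"
proof (rule lhopital_right[where f' = f' and g' = "\<lambda>t. (real k + 1) * (t - t0) ^ k"])
  have "isCont f t0" using assms(1) by (rule DERIV_isCont)
  then show "(f \<longlongrightarrow> 0) (at_right t0)"
    using assms(2) by (metis isCont_def filterlim_at_split)
  show "((\<lambda>t. (t - t0) ^ Suc k) \<longlongrightarrow> 0) (at_right t0)"
    by (auto intro!: tendsto_eq_intros)
  have pos: "\<forall>\<^sub>F t in at_right t0. 0 < t - t0"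
    by (simp add: eventually_at_right_less)
  show "\<forall>\<^sub>F t in at_right t0. (t - t0) ^ Suc k \<noteq> 0"
    using pos by eventually_elim auto
  show "\<forall>\<^sub>F t in at_right t0. (real k + 1) * (t - t0) ^ k \<noteq> 0"
    using pos by eventually_elim auto
  show "\<forall>\<^sub>F t in at_right t0. (f has_real_derivative f' t) (at t)" using assms(1) by simp
  show "\<forall>\<^sub>F t in at_right t0. ((\<lambda>t. (t - t0) ^ Suc k) has_real_derivative (real k + 1) * (t - t0) ^ k) (at t)"
  proof (intro always_eventually allI)
    fix t
    have "((\<lambda>t. t - t0) has_real_derivative 1) (at t)" by (auto intro!: derivative_eq_intros)
    from DERIV_power[OF this, of "Suc k"]
    show "((\<lambda>t. (t - t0) ^ Suc k) has_real_derivative (real k + 1) * (t - t0) ^ k) (at t)"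
      by (simp add: add.commute)
  qed
  have "((\<lambda>t. f' t / (t - t0) ^ k * (1 / (real k + 1))) \<longlongrightarrow> l * (1 / (real k + 1))) (at_right t0)"
    by (intro tendsto_intros lim)
  then show "((\<lambda>t. f' t / ((real k + 1) * (t - t0) ^ k)) \<longlongrightarrow> l / (real k + 1)) (at_right t0)"
    by (simp add: field_simps)
qed

text \<open>Induction on the distance k: order k + 1 of X i comes from order k of the right-hand
  side. At i - 1 and i + 1 only the outer of the two entries at distance k survives, since the inner
  one lies within the zero range around i; the diagonal term has order higher than k. Positivity of
  the off-diagonal coefficients keeps the weights positive.\<close>

lemma jacobi_leading_order:
  fixes X a b c :: "int \<Rightarrow> real \<Rightarrow> real"
  assumes out: "\<And>i t. i < 0 \<or> n \<le> i \<Longrightarrow> X i t = 0"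
    and der: "\<And>i t. 0 \<le> i \<Longrightarrow> i < n \<Longrightarrow>
       (X i has_real_derivative a i t * X (i - 1) t + b i t * X i t + c i t * X (i + 1) t) (at t)"
    and cont: "\<And>i. isCont (a i) t0" "\<And>i. isCont (b i) t0" "\<And>i. isCont (c i) t0"
    and pos: "\<And>i. 0 < a i t0" "\<And>i. 0 < c i t0"
    and i: "0 \<le> i" "i < n" and z: "\<And>j. \<bar>i - j\<bar> < int k \<Longrightarrow> X j t0 = 0"
  shows "\<exists>\<alpha>>0. \<exists>\<gamma>>0. ((\<lambda>t. X i t / (t - t0) ^ k) \<longlongrightarrow>
           \<alpha> * X (i - int k) t0 + \<gamma> * X (i + int k) t0) (at_right t0)"
  using i z
proof (induction k arbitrary: i)
  case 0
  have "isCont (X i) t0" using der[OF 0(1,2)] by (rule DERIV_isCont)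
  then have "(X i \<longlongrightarrow> X i t0) (at_right t0)" by (metis isCont_def filterlim_at_split)
  \<comment> \<open>At distance 0 both entries are X i t0 itself, hence two weights of one
    half.\<close>
  then show ?case by (intro exI[of _ "1/2"] conjI) auto
next
  case (Suc k)
  note z = Suc.prems(3)
  have left: "\<exists>\<alpha>>0. ((\<lambda>t. X (i - 1) t / (t - t0) ^ k) \<longlongrightarrow> \<alpha> * X (i - int (Suc k)) t0) (at_right t0)"
  proof (cases "i = 0")
    case True
    \<comment> \<open>Left of the range both sides are zero, so any positive weight serves.\<close>
    then show ?thesis using out by (intro exI[of _ 1]) auto
  next
    case False
    have "\<exists>\<alpha>>0. \<exists>\<gamma>>0. ((\<lambda>t. X (i - 1) t / (t - t0) ^ k) \<longlongrightarrow>
           \<alpha> * X (i - 1 - int k) t0 + \<gamma> * X (i - 1 + int k) t0) (at_right t0)"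
      by (rule Suc.IH) (use False Suc.prems in \<open>auto intro!: z\<close>)
    then obtain \<alpha> \<gamma> where ag: "\<alpha> > 0" "\<gamma> > 0" "((\<lambda>t. X (i - 1) t / (t - t0) ^ k) \<longlongrightarrow>
           \<alpha> * X (i - 1 - int k) t0 + \<gamma> * X (i - 1 + int k) t0) (at_right t0)" by blast
    show ?thesis
    proof (cases "k = 0")
      \<comment> \<open>At distance 0 the inner and the outer entry coincide and their weights add
        up.\<close>
      case True then show ?thesis using ag by (intro exI[of _ "\<alpha> + \<gamma>"]) (simp add: distrib_right)
    next
      case False then have "X (i - 1 + int k) t0 = 0" by (intro z) auto
      then show ?thesis using ag by (intro exI[of _ "\<alpha>"]) (simp add: algebra_simps)
    qed
  qed
  have right: "\<exists>\<gamma>>0. ((\<lambda>t. X (i + 1) t / (t - t0) ^ k) \<longlongrightarrow> \<gamma> * X (i + int (Suc k)) t0) (at_right t0)"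
  proof (cases "i = n - 1")
    case True
    then show ?thesis using out by (intro exI[of _ 1]) auto
  next
    case False
    have "\<exists>\<alpha>>0. \<exists>\<gamma>>0. ((\<lambda>t. X (i + 1) t / (t - t0) ^ k) \<longlongrightarrow>
           \<alpha> * X (i + 1 - int k) t0 + \<gamma> * X (i + 1 + int k) t0) (at_right t0)"
      by (rule Suc.IH) (use False Suc.prems in \<open>auto intro!: z\<close>)
    then obtain \<alpha> \<gamma> where ag: "\<alpha> > 0" "\<gamma> > 0" "((\<lambda>t. X (i + 1) t / (t - t0) ^ k) \<longlongrightarrow>
           \<alpha> * X (i + 1 - int k) t0 + \<gamma> * X (i + 1 + int k) t0) (at_right t0)" by blast
    show ?thesis
    proof (cases "k = 0")
      case True then show ?thesis using ag by (intro exI[of _ "\<alpha> + \<gamma>"]) (simp add: distrib_right)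
    next
      case False then have "X (i + 1 - int k) t0 = 0" by (intro z) auto
      then show ?thesis using ag by (intro exI[of _ "\<gamma>"]) (simp add: algebra_simps)
    qed
  qed
  have mid: "((\<lambda>t. X i t / (t - t0) ^ k) \<longlongrightarrow> 0) (at_right t0)"
  proof -
    have "\<exists>\<alpha>>0. \<exists>\<gamma>>0. ((\<lambda>t. X i t / (t - t0) ^ k) \<longlongrightarrow>
           \<alpha> * X (i - int k) t0 + \<gamma> * X (i + int k) t0) (at_right t0)"
      by (rule Suc.IH) (use Suc.prems in \<open>auto intro!: z\<close>)
    moreover have "X (i - int k) t0 = 0" "X (i + int k) t0 = 0" by (rule z; simp)+
    ultimately show ?thesis by auto
  qed
  obtain \<alpha> where \<alpha>: "\<alpha> > 0" "((\<lambda>t. X (i - 1) t / (t - t0) ^ k) \<longlongrightarrow> \<alpha> * X (i - int (Suc k)) t0) (at_right t0)"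
    using left by blast
  obtain \<gamma> where \<gamma>: "\<gamma> > 0" "((\<lambda>t. X (i + 1) t / (t - t0) ^ k) \<longlongrightarrow> \<gamma> * X (i + int (Suc k)) t0) (at_right t0)"
    using right by blast
  have c: "(a i \<longlongrightarrow> a i t0) (at_right t0)" "(b i \<longlongrightarrow> b i t0) (at_right t0)" "(c i \<longlongrightarrow> c i t0) (at_right t0)"
    using cont by (metis isCont_def filterlim_at_split)+
  let ?L = "X (i - int (Suc k)) t0" and ?R = "X (i + int (Suc k)) t0"
  have "((\<lambda>t. a i t * (X (i - 1) t / (t - t0) ^ k) + b i t * (X i t / (t - t0) ^ k)
         + c i t * (X (i + 1) t / (t - t0) ^ k)) \<longlongrightarrow> a i t0 * (\<alpha> * ?L) + b i t0 * 0 + c i t0 * (\<gamma> * ?R)) (at_right t0)"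
    by (intro tendsto_intros c \<alpha> \<gamma> mid)
  then have "((\<lambda>t. (a i t * X (i - 1) t + b i t * X i t + c i t * X (i + 1) t) / (t - t0) ^ k)
       \<longlongrightarrow> a i t0 * (\<alpha> * ?L) + c i t0 * (\<gamma> * ?R)) (at_right t0)"
    by (simp add: add_divide_distrib)
  then have "((\<lambda>t. X i t / (t - t0) ^ Suc k) \<longlongrightarrow>
      (a i t0 * (\<alpha> * ?L) + c i t0 * (\<gamma> * ?R)) / (real k + 1)) (at_right t0)"
    by (intro lhopital_power_step[OF der]) (use Suc.prems in auto)
  then show ?case
    using pos \<alpha> \<gamma>
    by (intro exI[of _ "a i t0 * \<alpha> / (real k + 1)"] conjI exI[of _ "c i t0 * \<gamma> / (real k + 1)"])
       (auto simp: add_divide_distrib mult.assoc)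
qed

lemma jacobi_follows_nearest:
  fixes X a b c :: "int \<Rightarrow> real \<Rightarrow> real"
  assumes out: "\<And>i t. i < 0 \<or> n \<le> i \<Longrightarrow> X i t = 0"
    and der: "\<And>i t. 0 \<le> i \<Longrightarrow> i < n \<Longrightarrow>
       (X i has_real_derivative a i t * X (i - 1) t + b i t * X i t + c i t * X (i + 1) t) (at t)"
    and cont: "\<And>i. isCont (a i) t0" "\<And>i. isCont (b i) t0" "\<And>i. isCont (c i) t0"
    and pos: "\<And>i. 0 < a i t0" "\<And>i. 0 < c i t0"
  shows "\<forall>\<^sub>F t in at_right t0. follows_nearest n (\<lambda>i. X i t0) (\<lambda>i. X i t)"
proof -
  let ?u = "\<lambda>i. X i t0"
  have ev: "\<forall>\<^sub>F t in at_right t0. 0 < s * X i t"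
    if i: "0 \<le> i" "i < n" and s: "nearest_sign ?u d i s" for i d s
  proof -
    obtain \<alpha> \<gamma> where ag: "\<alpha> > 0" "\<gamma> > 0" "((\<lambda>t. X i t / (t - t0) ^ d) \<longlongrightarrow>
           \<alpha> * ?u (i - int d) + \<gamma> * ?u (i + int d)) (at_right t0)"
      using jacobi_leading_order[OF out der cont pos i, of d] s by (auto simp: nearest_sign_def)
    have "((\<lambda>t. s * (X i t / (t - t0) ^ d)) \<longlongrightarrow> s * (\<alpha> * ?u (i - int d) + \<gamma> * ?u (i + int d))) (at_right t0)"
      by (intro tendsto_intros ag)
    moreover have "0 < s * (\<alpha> * ?u (i - int d) + \<gamma> * ?u (i + int d))"
    proof -
      have "0 < s * ?u (i - int d) \<or> 0 < s * ?u (i + int d)" "0 \<le> s * ?u (i - int d)" "0 \<le> s * ?u (i + int d)"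
        using s unfolding nearest_sign_def by (auto simp: distrib_left)
      then have "0 < \<alpha> * (s * ?u (i - int d)) + \<gamma> * (s * ?u (i + int d))"
        using ag by (auto intro: add_pos_nonneg add_nonneg_pos)
      then show ?thesis by (simp add: algebra_simps)
    qed
    ultimately have "\<forall>\<^sub>F t in at_right t0. 0 < s * (X i t / (t - t0) ^ d)"
      by (rule order_tendstoD)
    moreover have "\<forall>\<^sub>F t in at_right t0. 0 < t - t0"
      by (simp add: eventually_at_right_less)
    ultimately show ?thesis
      by eventually_elim (simp add: zero_less_mult_iff divide_less_0_iff zero_less_divide_iff)
  qed
  \<comment> \<open>For d beyond n both entries at distance d lie outside the range and vanish, so
    only finitely many triples matter and one right neighbourhood of t0 serves them all.\<close>
  let ?I = "{(i, d, s). i \<in> {0..<n} \<and> d \<in> {..nat n} \<and> s \<in> {1, -1 :: real} \<and> nearest_sign ?u d i s}"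
  have "finite ({0..<n} \<times> {..nat n} \<times> {1, -1 :: real})" by simp
  then have "finite ?I" by (rule rev_finite_subset) auto
  then have "\<forall>\<^sub>F t in at_right t0. \<forall>(i, d, s) \<in> ?I. 0 < s * X i t"
    by (rule eventually_ball_finite) (auto intro: ev)
  then show ?thesis
  proof eventually_elim
    case (elim t)
    show ?case unfolding follows_nearest_def
    proof (intro allI impI)
      fix i s and d :: nat
      assume a: "0 \<le> i \<and> i < n \<and> s \<in> {1, - 1} \<and> nearest_sign ?u d i s"
      have "d \<le> nat n"
      proof (rule ccontr)
        assume "\<not> d \<le> nat n"
        then have "?u (i - int d) = 0" "?u (i + int d) = 0" using a by (auto intro!: out)
        then show False using a by (auto simp: nearest_sign_def)
      qed
      then show "0 < s * X i t" using elim a by auto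
    qed
  qed
qed

section \<open>Linear skew-product flows\<close>

text \<open>The squared norm is differentiable at zeros of f as well. The forcing is absorbed
  through 2 \<eta> r \<le> r^2 + \<eta>^2, which is the origin of the extra 1 in the exponent. With
  \<eta> = 0 this yields growth bounds and uniqueness, with a small \<eta> continuous
  dependence.\<close>

lemma gronwall_norm:
  fixes f :: "real \<Rightarrow> 'a::real_inner"
  assumes "0 \<le> T" and d: "\<And>t. 0 \<le> t \<Longrightarrow> t \<le> T \<Longrightarrow> (f has_vector_derivative f' t) (at t)"
    and b: "\<And>t. 0 \<le> t \<Longrightarrow> t \<le> T \<Longrightarrow> norm (f' t) \<le> M * norm (f t) + \<eta>"
    and "0 \<le> M"
  shows "(norm (f T))\<^sup>2 \<le> ((norm (f 0))\<^sup>2 + \<eta>\<^sup>2) * exp ((2 * M + 1) * T)"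
proof -
  define g where "g t = (f t \<bullet> f t + \<eta>\<^sup>2) * exp (- (2 * M + 1) * t)" for t
  have "g T \<le> g 0"
  proof (rule DERIV_nonpos_imp_nonincreasing[OF \<open>0 \<le> T\<close>])
    fix t assume t: "0 \<le> t" "t \<le> T"
    have "((\<lambda>t. f t \<bullet> f t) has_vector_derivative (f t \<bullet> f' t + f' t \<bullet> f t)) (at t)"
      by (rule bounded_bilinear.has_vector_derivative[OF bounded_bilinear_inner d d]) (use t in auto)
    then have "((\<lambda>t. f t \<bullet> f t) has_real_derivative (2 * (f t \<bullet> f' t))) (at t)"
      by (simp add: has_real_derivative_iff_has_vector_derivative inner_commute)
    then have D: "(g has_real_derivative
        (2 * (f t \<bullet> f' t) - (2 * M + 1) * (f t \<bullet> f t + \<eta>\<^sup>2)) * exp (- (2 * M + 1) * t)) (at t)"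
      unfolding g_def by (auto intro!: derivative_eq_intros simp: algebra_simps)
    let ?r = "norm (f t)"
    have "f t \<bullet> f' t \<le> ?r * norm (f' t)" by (rule norm_cauchy_schwarz)
    also have "\<dots> \<le> ?r * (M * ?r + \<eta>)" by (intro mult_left_mono b t) auto
    finally have 1: "2 * (f t \<bullet> f' t) \<le> 2 * M * ?r\<^sup>2 + 2 * \<eta> * ?r"
      by (simp add: algebra_simps power2_eq_square)
    have 2: "2 * \<eta> * ?r \<le> ?r\<^sup>2 + \<eta>\<^sup>2" using sum_squares_bound[of \<eta> ?r] by simp
    have 3: "(2 * M + 1) * (f t \<bullet> f t + \<eta>\<^sup>2) = 2 * M * ?r\<^sup>2 + ?r\<^sup>2 + \<eta>\<^sup>2 + 2 * M * \<eta>\<^sup>2"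
      by (simp add: power2_norm_eq_inner algebra_simps)
    have "2 * (f t \<bullet> f' t) - (2 * M + 1) * (f t \<bullet> f t + \<eta>\<^sup>2) \<le> 0"
    proof -
      have "0 \<le> 2 * M * \<eta>\<^sup>2" using \<open>0 \<le> M\<close> by simp
      then show ?thesis unfolding 3 using 1 2 by linarith
    qed
    then show "\<exists>y. (g has_real_derivative y) (at t) \<and> y \<le> 0"
      using D by (blast intro: mult_nonpos_nonneg exp_ge_zero)
  qed
  then have "(norm (f T))\<^sup>2 + \<eta>\<^sup>2 \<le> ((norm (f 0))\<^sup>2 + \<eta>\<^sup>2) * exp ((2 * M + 1) * T)"
  proof -
    define E where "E = exp ((2 * M + 1) * T)"
    have E: "E > 0" "exp (- (2 * M + 1) * T) = inverse E"
      unfolding E_def by (auto simp: algebra_simps simp flip: exp_minus)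
    have "(f T \<bullet> f T + \<eta>\<^sup>2) / E \<le> f 0 \<bullet> f 0 + \<eta>\<^sup>2"
      using \<open>g T \<le> g 0\<close> unfolding g_def E(2) by (simp add: divide_inverse)
    then have "f T \<bullet> f T + \<eta>\<^sup>2 \<le> (f 0 \<bullet> f 0 + \<eta>\<^sup>2) * E"
      using E(1) by (simp only: pos_divide_le_eq)
    then show ?thesis unfolding E_def power2_norm_eq_inner .
  qed
  then show ?thesis using zero_le_power2[of \<eta>] by linarith
qed

lemma bounded_bilinear_matrix_vector_mult:
  "bounded_bilinear ((*v) :: real^'n^'m \<Rightarrow> real^'n \<Rightarrow> real^'m)"
  by (subst bilinear_conv_bounded_bilinear[symmetric])
     (auto simp: bilinear_def linear_iff matrix_vector_mult_add_rdistrib algebra_simps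
        scaleR_matrix_vector_assoc matrix_vector_mult_scaleR)

text \<open>Kept apart from the Jacobi sign conditions because time reversal replaces B by -B, which
  destroys the positivity of the off-diagonal entries but preserves everything assumed here.\<close>

locale linear_flow =
  fixes Y :: "'y::metric_space set"
    and flow :: "'y \<Rightarrow> real \<Rightarrow> 'y"
    and B :: "'y \<Rightarrow> real^'n::finite^'n"
    and Phi :: "real \<Rightarrow> 'y \<Rightarrow> real^'n^'n"
  assumes Y_compact: "compact Y"
    and flow_in: "\<And>y t. y \<in> Y \<Longrightarrow> flow y t \<in> Y"
    and flow_cont: "continuous_on (Y \<times> UNIV) (\<lambda>(y, t). flow y t)"
    and flow_0: "\<And>y. y \<in> Y \<Longrightarrow> flow y 0 = y"
    and flow_add: "\<And>y s t. y \<in> Y \<Longrightarrow> flow (flow y s) t = flow y (s + t)"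
    and B_cont: "continuous_on Y B"
    and Phi_0: "\<And>y. y \<in> Y \<Longrightarrow> Phi 0 y = mat 1"
    and Phi_deriv: "\<And>y t. y \<in> Y \<Longrightarrow>
          ((\<lambda>s. Phi s y) has_vector_derivative (B (flow y t) ** Phi t y)) (at t)"
begin

text \<open>Every forward-time result of this locale thereby holds backward in time.\<close>

lemma reverse: "linear_flow Y (\<lambda>y t. flow y (- t)) (\<lambda>y. - B y) (\<lambda>t. Phi (- t))"
proof
  show "continuous_on (Y \<times> UNIV) (\<lambda>(y, t). flow y (- t))"
  proof -
    have "continuous_on (Y \<times> UNIV) ((\<lambda>(y, t). flow y t) \<circ> (\<lambda>p. (fst p, - snd p)))"
      by (intro continuous_on_compose continuous_intros continuous_on_subset[OF flow_cont]) auto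
    then show ?thesis by (simp add: o_def case_prod_unfold)
  qed
  show "continuous_on Y (\<lambda>y. - B y)" by (intro continuous_intros B_cont)
  fix y t assume y: "y \<in> Y"
  have "((\<lambda>s. Phi s y) \<circ> uminus has_vector_derivative (-1) *\<^sub>R (B (flow y (- t)) ** Phi (- t) y)) (at t)"
    by (rule vector_diff_chain_at) (auto intro!: derivative_eq_intros Phi_deriv y)
  moreover have "(-1) *\<^sub>R (B (flow y (- t)) ** Phi (- t) y) = - B (flow y (- t)) ** Phi (- t) y"
    by (simp add: vec_eq_iff matrix_matrix_mult_def sum_negf)
  ultimately show "((\<lambda>s. Phi (- s) y) has_vector_derivative - B (flow y (- t)) ** Phi (- t) y) (at t)"
    by (simp add: o_def)
qed (use Y_compact flow_in flow_0 flow_add Phi_0 in auto)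

lemma solution_deriv:
  assumes "y \<in> Y"
  shows "((\<lambda>s. Phi s y *v x) has_vector_derivative (B (flow y t) *v (Phi t y *v x))) (at t)"
  using bounded_linear.has_vector_derivative[OF
      bounded_bilinear.bounded_linear_left[OF bounded_bilinear_matrix_vector_mult] Phi_deriv[OF assms]]
  by (simp add: matrix_vector_mul_assoc)

lemma solution_cont: "y \<in> Y \<Longrightarrow> isCont (\<lambda>s. Phi s y *v x) t"
  using solution_deriv has_vector_derivative_continuous by blast

lemma coeff_bound:
  obtains M where "0 < M" "\<And>y x. y \<in> Y \<Longrightarrow> norm (B y *v x) \<le> M * norm x"
proof -
  obtain K where K: "0 \<le> K" "\<And>(A::real^'n^'n) x. norm (A *v x) \<le> norm A * norm x * K"
    using bounded_bilinear.nonneg_bounded[OF bounded_bilinear_matrix_vector_mult] by blast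
  have "bounded (B ` Y)"
    by (intro compact_imp_bounded compact_continuous_image B_cont Y_compact)
  then obtain N where N: "N > 0" "\<And>y. y \<in> Y \<Longrightarrow> norm (B y) \<le> N"
    unfolding bounded_pos by auto
  show ?thesis
  proof (rule that[of "N * K + 1"])
    show "0 < N * K + 1" using N K by (simp add: add_nonneg_pos)
    fix y x assume y: "y \<in> Y"
    have "norm (B y *v x) \<le> norm (B y) * norm x * K" by (rule K)
    also have "\<dots> \<le> N * norm x * K" using N(2)[OF y] K by (intro mult_right_mono) auto
    also have "\<dots> \<le> (N * K + 1) * norm x" by (simp add: algebra_simps)
    finally show "norm (B y *v x) \<le> (N * K + 1) * norm x" .
  qed
qed

lemma growth_bound:
  obtains M where "0 < M" "\<And>y x t. y \<in> Y \<Longrightarrow> 0 \<le> t \<Longrightarrow> norm (Phi t y *v x) \<le> exp (M * t) * norm x"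
proof -
  obtain M where M: "0 < M" "\<And>y x. y \<in> Y \<Longrightarrow> norm (B y *v x) \<le> M * norm x"
    using coeff_bound by blast
  show ?thesis
  \<comment> \<open>Half of the exponent 2 * M + 1, because the estimate is for squared
    norms.\<close>
  proof (rule that[of "M + 1/2"])
    fix y x and t :: real assume y: "y \<in> Y" and t: "0 \<le> t"
    have "(norm (Phi t y *v x))\<^sup>2 \<le> ((norm (Phi 0 y *v x))\<^sup>2 + 0\<^sup>2) * exp ((2 * M + 1) * t)"
      by (rule gronwall_norm[OF t solution_deriv[OF y]]) (use M flow_in y in auto)
    also have "\<dots> = (exp ((M + 1/2) * t) * norm x)\<^sup>2"
      by (simp add: Phi_0 y power_mult_distrib exp_double[symmetric] algebra_simps)
    finally show "norm (Phi t y *v x) \<le> exp ((M + 1/2) * t) * norm x"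
      by (rule power2_le_imp_le) auto
  qed (use M in auto)
qed

text \<open>Both sides solve the same linear equation in t with the same value at t = 0, so their
  difference vanishes by \<open>gronwall_norm\<close> with \<eta> = 0.\<close>

lemma cocycle_nonneg:
  assumes y: "y \<in> Y" and t: "0 \<le> t"
  shows "Phi t (flow y s) *v (Phi s y *v x) = Phi (s + t) y *v x"
proof -
  obtain M where M: "0 < M" "\<And>y x. y \<in> Y \<Longrightarrow> norm (B y *v x) \<le> M * norm x"
    using coeff_bound by blast
  define f where "f t = Phi t (flow y s) *v (Phi s y *v x) - Phi (s + t) y *v x" for t
  have "(norm (f t))\<^sup>2 \<le> ((norm (f 0))\<^sup>2 + 0\<^sup>2) * exp ((2 * M + 1) * t)"
  proof (rule gronwall_norm[OF t, where f' = "\<lambda>t. B (flow y (s + t)) *v f t"])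
    fix t
    have 1: "((\<lambda>t. Phi t (flow y s) *v (Phi s y *v x)) has_vector_derivative
        B (flow y (s + t)) *v (Phi t (flow y s) *v (Phi s y *v x))) (at t)"
      using solution_deriv[OF flow_in[OF y], of s "Phi s y *v x" t] by (simp add: flow_add y)
    have "((\<lambda>r. Phi r y *v x) \<circ> (\<lambda>t. s + t) has_vector_derivative
        1 *\<^sub>R (B (flow y (s + t)) *v (Phi (s + t) y *v x))) (at t)"
      by (rule vector_diff_chain_at) (auto intro!: derivative_eq_intros solution_deriv y)
    then have 2: "((\<lambda>t. Phi (s + t) y *v x) has_vector_derivative
        B (flow y (s + t)) *v (Phi (s + t) y *v x)) (at t)"
      by (simp add: o_def)
    show "(f has_vector_derivative B (flow y (s + t)) *v f t) (at t)"
      using has_vector_derivative_diff[OF 1 2] unfolding f_def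
      by (simp add: matrix_vector_mult_diff_distrib)
  qed (use M y flow_in in auto)
  moreover have "f 0 = 0" by (simp add: f_def Phi_0 y flow_in)
  ultimately show ?thesis by (simp add: f_def)
qed

lemma cocycle:
  assumes y: "y \<in> Y"
  shows "Phi t (flow y s) *v (Phi s y *v x) = Phi (s + t) y *v x"
proof (cases "0 \<le> t")
  case True then show ?thesis using cocycle_nonneg[OF y] by blast
next
  case False
  interpret R: linear_flow Y "\<lambda>y t. flow y (- t)" "\<lambda>y. - B y" "\<lambda>t. Phi (- t)" by (rule reverse)
  show ?thesis using R.cocycle_nonneg[OF y, of "- t" "- s"] False by (simp add: add.commute)
qed

lemma solution_inverse: "y \<in> Y \<Longrightarrow> Phi (- t) (flow y t) *v (Phi t y *v x) = x"
  using cocycle[of y "- t" t x] by (simp add: Phi_0)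

lemma solution_nonzero: "y \<in> Y \<Longrightarrow> x \<noteq> 0 \<Longrightarrow> Phi t y *v x \<noteq> 0"
  using solution_inverse[of y t x] by auto

text \<open>Continuity of \<open>Phi\<close> in y is derived from its equation: by uniform
  continuity of B along orbits over Y and the time interval from 0 to 1, nearby base points give
  nearby coefficients, and Gronwall turns this into nearby solutions.\<close>

lemma time_one_cont: "continuous_on (Y \<times> UNIV) (\<lambda>(y, x). Phi 1 y *v x)"
proof -
  obtain M where M: "0 < M" "\<And>y x. y \<in> Y \<Longrightarrow> norm (B y *v x) \<le> M * norm x"
    using coeff_bound by blast
  obtain K where K: "0 < K" "\<And>(A::real^'n^'n) x. norm (A *v x) \<le> norm A * norm x * K"
    using bounded_bilinear.pos_bounded[OF bounded_bilinear_matrix_vector_mult] by blast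
  obtain M' where M': "0 < M'" "\<And>y x t. y \<in> Y \<Longrightarrow> 0 \<le> t \<Longrightarrow> norm (Phi t y *v x) \<le> exp (M' * t) * norm x"
    using growth_bound by blast
  have "continuous_on (Y \<times> {0..1::real}) (B \<circ> (\<lambda>(y, t). flow y t))"
    by (intro continuous_on_compose continuous_on_subset[OF flow_cont] continuous_on_subset[OF B_cont])
       (auto intro: flow_in)
  then have "uniformly_continuous_on (Y \<times> {0..1::real}) (B \<circ> (\<lambda>(y, t). flow y t))"
    by (intro compact_uniformly_continuous compact_Times Y_compact) auto
  then have uc: "\<exists>d>0. \<forall>y\<in>Y. \<forall>y'\<in>Y. \<forall>t\<in>{0..1}. dist y y' < d \<longrightarrow> norm (B (flow y t) - B (flow y' t)) < \<eta>"
    if "\<eta> > 0" for \<eta>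
  proof -
    obtain d where d: "d > 0" "\<And>p q. p \<in> Y \<times> {0..1::real} \<Longrightarrow> q \<in> Y \<times> {0..1} \<Longrightarrow> dist p q < d \<Longrightarrow>
        dist ((B \<circ> (\<lambda>(y, t). flow y t)) p) ((B \<circ> (\<lambda>(y, t). flow y t)) q) < \<eta>"
      using \<open>uniformly_continuous_on _ _\<close> \<open>\<eta> > 0\<close> unfolding uniformly_continuous_on_def
      by (metis dist_commute)
    have "norm (B (flow y t) - B (flow y' t)) < \<eta>"
      if "y \<in> Y" "y' \<in> Y" "t \<in> {0..1}" "dist y y' < d" for y y' t
      using d(2)[of "(y, t)" "(y', t)"] that by (simp add: dist_Pair_Pair dist_norm)
    then show ?thesis using d(1) by blast
  qed
  have est: "(norm (Phi 1 y *v x - Phi 1 y0 *v x0))\<^sup>2 \<le> ((norm (x - x0))\<^sup>2 + (\<eta> * (exp M' * norm x0) * K)\<^sup>2) * exp (2 * M + 1)"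
    if y: "y \<in> Y" "y0 \<in> Y" and \<eta>: "\<And>t. t \<in> {0..1} \<Longrightarrow> norm (B (flow y t) - B (flow y0 t)) \<le> \<eta>" for y y0 x x0 \<eta>
  proof -
    define f where "f t = Phi t y *v x - Phi t y0 *v x0" for t
    have \<eta>0: "0 \<le> \<eta>" using \<eta>[of 0] norm_ge_zero by (meson atLeastAtMost_iff order_trans order_refl zero_le_one)
    have "(norm (f 1))\<^sup>2 \<le> ((norm (f 0))\<^sup>2 + (\<eta> * (exp M' * norm x0) * K)\<^sup>2) * exp ((2 * M + 1) * 1)"
    \<comment> \<open>The difference solves the equation over y, forced by the difference of
      coefficients acting on the bounded solution over y0.\<close>
    proof (rule gronwall_norm[where f' = "\<lambda>t. B (flow y t) *v f t + (B (flow y t) - B (flow y0 t)) *v (Phi t y0 *v x0)"])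
      fix t :: real assume t: "0 \<le> t" "t \<le> 1"
      show "(f has_vector_derivative B (flow y t) *v f t + (B (flow y t) - B (flow y0 t)) *v (Phi t y0 *v x0)) (at t)"
        using has_vector_derivative_diff[OF solution_deriv[OF y(1), of x t] solution_deriv[OF y(2), of x0 t]]
        unfolding f_def by (simp add: matrix_vector_mult_diff_distrib matrix_vector_mult_diff_rdistrib)
      have "norm (Phi t y0 *v x0) \<le> exp (M' * t) * norm x0" using M' y t by blast
      also have "\<dots> \<le> exp M' * norm x0" using M' t by (intro mult_right_mono) auto
      finally have p: "norm (Phi t y0 *v x0) \<le> exp M' * norm x0" .
      have "norm ((B (flow y t) - B (flow y0 t)) *v (Phi t y0 *v x0))
          \<le> norm (B (flow y t) - B (flow y0 t)) * norm (Phi t y0 *v x0) * K" by (rule K(2))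
      also have "\<dots> \<le> \<eta> * (exp M' * norm x0) * K"
        using K(1) by (intro mult_right_mono mult_mono p \<eta> \<eta>0) (use t in auto)
      finally have "norm ((B (flow y t) - B (flow y0 t)) *v (Phi t y0 *v x0)) \<le> \<eta> * (exp M' * norm x0) * K" .
      then show "norm (B (flow y t) *v f t + (B (flow y t) - B (flow y0 t)) *v (Phi t y0 *v x0)) \<le> M * norm (f t) + \<eta> * (exp M' * norm x0) * K"
        using M(2)[OF flow_in[OF y(1)], of t "f t"] by (intro norm_triangle_le) linarith
    qed (use M in auto)
    then show ?thesis by (simp add: f_def Phi_0 y)
  qed
  show ?thesis
    unfolding continuous_on_iff
  proof (clarsimp simp: dist_norm)
    fix y0 and x0 :: "real^'n" and e :: real assume y0: "y0 \<in> Y" and e: "0 < e"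
    define E where "E = exp (2 * M + 1)"
    define C where "C = exp M' * norm x0 * K + 1"
    have C: "C > 0" using K unfolding C_def by (simp add: add_nonneg_pos)
    have E: "E > 0" by (simp add: E_def)
    \<comment> \<open>Initial difference and forcing are each kept below r, with C absorbing the
      constants of the forcing; then 2 r^2 E = e^2 / 2 stays below e^2.\<close>
    define r where "r = e / (2 * sqrt E)"
    have r: "r > 0" using e E by (simp add: r_def)
    obtain d where d: "d > 0" "\<forall>y\<in>Y. \<forall>y'\<in>Y. \<forall>t\<in>{0..1}. dist y y' < d \<longrightarrow> norm (B (flow y t) - B (flow y' t)) < r / C"
      using uc[of "r / C"] r C by auto
    show "\<exists>d>0. \<forall>y\<in>Y. \<forall>x. dist (y, x) (y0, x0) < d \<longrightarrow> norm (Phi 1 y *v x - Phi 1 y0 *v x0) < e"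
    proof (intro exI conjI ballI allI impI)
      show "0 < min d r" using d r by simp
      fix y and x :: "real^'n" assume y: "y \<in> Y" and "dist (y, x) (y0, x0) < min d r"
      then have yx: "dist y y0 < d" "norm (x - x0) < r"
        using dist_fst_le[of "(y, x)" "(y0, x0)"] dist_snd_le[of "(y, x)" "(y0, x0)"]
        by (auto simp: dist_norm)
      have "(norm (Phi 1 y *v x - Phi 1 y0 *v x0))\<^sup>2 \<le> ((norm (x - x0))\<^sup>2 + (r / C * (exp M' * norm x0) * K)\<^sup>2) * E"
        unfolding E_def by (rule est) (use y y0 yx d in \<open>auto intro: less_imp_le\<close>)
      also have "\<dots> \<le> (r\<^sup>2 + r\<^sup>2) * E"
      proof (intro mult_right_mono add_mono power_mono)
        have "r / C * (exp M' * norm x0) * K = r * ((C - 1) / C)" by (simp add: C_def)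
        also have "\<dots> \<le> r * 1" using r C by (intro mult_left_mono) auto
        finally show "r / C * (exp M' * norm x0) * K \<le> r" by simp
      qed (use yx r C K E in auto)
      also have "\<dots> = e\<^sup>2 / 2" using E by (simp add: r_def power_divide power_mult_distrib)
      also have "\<dots> < e\<^sup>2" using e by simp
      finally show "norm (Phi 1 y *v x - Phi 1 y0 *v x0) < e"
        using e by (meson power2_less_imp_less less_imp_le)
    qed
  qed
qed

end

section \<open>Sign changes along solutions\<close>

text \<open>Extending by zero on both sides lets the first and the last coordinate satisfy the same
  three-term equation as the inner ones.\<close>

definition padded :: "(nat \<Rightarrow> 'n::finite) \<Rightarrow> real^'n \<Rightarrow> int \<Rightarrow> real" where
  "padded e x i = (if 0 \<le> i \<and> i < int CARD('n) then x $ e (nat i) else 0)"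

lemma padded_outside: "i < 0 \<or> int CARD('n) \<le> i \<Longrightarrow> padded (e :: nat \<Rightarrow> 'n::finite) x i = 0"
  by (auto simp: padded_def)

lemma coord_padded: "k < CARD('n) \<Longrightarrow> coord (e :: nat \<Rightarrow> 'n::finite) x k = padded e x (int k)"
  by (auto simp: padded_def coord_def)

lemma padded_nonzero:
  fixes e :: "nat \<Rightarrow> 'n::finite"
  assumes "bij_betw e {..<CARD('n)} UNIV" "x \<noteq> 0"
  obtains k where "padded e x k \<noteq> 0"
proof -
  obtain j where j: "x $ j \<noteq> 0" using assms(2) by (auto simp: vec_eq_iff)
  obtain k where "k < CARD('n)" "e k = j" using assms(1) by (metis bij_betw_def UNIV_I imageE lessThan_iff)
  then have "padded e x (int k) \<noteq> 0" using j by (simp add: padded_def)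
  then show ?thesis using that by blast
qed

lemma Lambda_set_alternating:
  fixes e :: "nat \<Rightarrow> 'n::finite"
  shows "x \<in> Lambda_set e \<longleftrightarrow> alternating (int CARD('n)) (padded e x)"
proof -
  have N: "0 < CARD('n)" by simp
  have "coord e x 0 = padded e x 0" "coord e x (CARD('n) - 1) = padded e x (int CARD('n) - 1)"
    using coord_padded[of 0 e x] coord_padded[of "CARD('n) - 1" e x] N by (auto simp: of_nat_diff)
  moreover have "(\<forall>i. 1 \<le> i \<and> i \<le> CARD('n) - 2 \<longrightarrow> coord e x i = 0 \<longrightarrow> coord e x (i - 1) * coord e x (i + 1) < 0)
    \<longleftrightarrow> (\<forall>i. 0 < i \<and> i < int CARD('n) - 1 \<and> padded e x i = 0 \<longrightarrow> padded e x (i - 1) * padded e x (i + 1) < 0)"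
    (is "?A \<longleftrightarrow> ?B")
  proof
    assume A: ?A
    show ?B
    proof (intro allI impI)
      fix i assume i: "0 < i \<and> i < int CARD('n) - 1 \<and> padded e x i = 0"
      define k where "k = nat i"
      have k: "i = int k" "1 \<le> k" "k + 1 < CARD('n)" using i by (auto simp: k_def)
      have "coord e x k = padded e x i" "coord e x (k - 1) = padded e x (i - 1)" "coord e x (k + 1) = padded e x (i + 1)"
        using coord_padded[of k e x] coord_padded[of "k - 1" e x] coord_padded[of "k + 1" e x] k
        by (auto simp: of_nat_diff add.commute)
      then show "padded e x (i - 1) * padded e x (i + 1) < 0" using A[rule_format, of k] k i by auto
    qed
  next
    assume B: ?B
    show ?A
    proof (intro allI impI)
      fix k assume k: "1 \<le> k \<and> k \<le> CARD('n) - 2" "coord e x k = 0"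
      have "coord e x k = padded e x (int k)" "coord e x (k - 1) = padded e x (int k - 1)" "coord e x (k + 1) = padded e x (int k + 1)"
        using coord_padded[of k e x] coord_padded[of "k - 1" e x] coord_padded[of "k + 1" e x] k
        by (auto simp: of_nat_diff add.commute)
      then show "coord e x (k - 1) * coord e x (k + 1) < 0" using B[rule_format, of "int k"] k by auto
    qed
  qed
  ultimately show ?thesis unfolding Lambda_set_def alternating_def by simp
qed

lemma sigma_changes:
  fixes e :: "nat \<Rightarrow> 'n::finite"
  shows "sigma e x = card (changes (int CARD('n)) (padded e x))"
proof -
  let ?S = "{i. i < CARD('n) - 1 \<and> (coord e x i = 0 \<or> coord e x i * coord e x (i + 1) < 0)}"
  have c: "coord e x k = padded e x (int k)" "coord e x (k + 1) = padded e x (int k + 1)" if "k < CARD('n) - 1" for k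
    using that coord_padded[of k e x] coord_padded[of "k + 1" e x] by (auto simp: add.commute)
  have "changes (int CARD('n)) (padded e x) = int ` ?S"
  proof (intro equalityI subsetI)
    fix i assume i: "i \<in> changes (int CARD('n)) (padded e x)"
    then have k: "i = int (nat i)" "nat i < CARD('n) - 1" by (auto simp: changes_def)
    then have "nat i \<in> ?S" using i c[OF k(2)] by (auto simp: changes_def)
    then show "i \<in> int ` ?S" using k by blast
  next
    fix i assume "i \<in> int ` ?S"
    then obtain k where k: "i = int k" "k \<in> ?S" by blast
    then show "i \<in> changes (int CARD('n)) (padded e x)" using c[of k] by (auto simp: changes_def)
  qed
  then show ?thesis unfolding sigma_def by (simp add: card_image)
qed

text \<open>Stands in for closeness of z to u: it holds on a neighbourhood of u, leaves z free where
  u vanishes, and is just what the comparison of counts requires.\<close>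

definition same_signs :: "(nat \<Rightarrow> 'n::finite) \<Rightarrow> real^'n \<Rightarrow> real^'n \<Rightarrow> bool" where
  "same_signs e u z \<longleftrightarrow> (\<forall>i. padded e u i \<noteq> 0 \<longrightarrow> 0 < padded e u i * padded e z i)"

lemma eventually_same_signs:
  fixes e :: "nat \<Rightarrow> 'n::finite"
  shows "\<forall>\<^sub>F z in nhds u. same_signs e u z"
proof -
  let ?I = "{i \<in> {0..<int CARD('n)}. padded e u i \<noteq> 0}"
  have "\<forall>\<^sub>F z in nhds u. 0 < padded e u i * padded e z i" if i: "i \<in> ?I" for i
  proof -
    have "((\<lambda>z. padded e u i * padded e z i) \<longlongrightarrow> padded e u i * padded e u i) (nhds u)"
      using i by (auto simp: padded_def intro!: tendsto_intros filterlim_ident)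
    moreover have "0 < padded e u i * padded e u i" using i by (simp add: zero_less_mult_iff) linarith
    ultimately show ?thesis by (rule order_tendstoD)
  qed
  then have "\<forall>\<^sub>F z in nhds u. \<forall>i\<in>?I. 0 < padded e u i * padded e z i"
    by (intro eventually_ball_finite finite_subset[of ?I "{0..<int CARD('n)}"]) auto
  then show ?thesis
  proof eventually_elim
    case (elim z)
    show ?case unfolding same_signs_def
    proof (intro allI impI)
      fix i assume n: "padded e u i \<noteq> 0"
      then have "i \<in> ?I" by (auto simp: padded_def split: if_splits)
      then show "0 < padded e u i * padded e z i" using elim by blast
    qed
  qed
qed

lemma follows_nearest_Lambda:
  fixes e :: "nat \<Rightarrow> 'n::finite"
  assumes "bij_betw e {..<CARD('n)} UNIV" "u \<noteq> 0"
    and F: "follows_nearest (int CARD('n)) (padded e u) (padded e v)"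
  shows "v \<in> Lambda_set e" "same_signs e u z \<Longrightarrow> sigma e v \<le> sigma e z"
proof -
  obtain k where k: "padded e u k \<noteq> 0" using padded_nonzero[OF assms(1,2)] by blast
  show "v \<in> Lambda_set e"
    unfolding Lambda_set_alternating by (rule follows_nearest_alternating[OF F padded_outside k])
  show "sigma e v \<le> sigma e z" if "same_signs e u z"
    unfolding sigma_changes using that
    by (intro card_changes_le[OF F padded_outside k]) (auto simp: same_signs_def)
qed

lemma Lambda_set_nonzero:
  fixes e :: "nat \<Rightarrow> 'n::finite"
  shows "x \<in> Lambda_set e \<Longrightarrow> x \<noteq> 0"
  by (auto simp: Lambda_set_def coord_def)

text \<open>Both u and z follow u, and both have the signs of u where it is nonzero. The comparison
  of counts therefore applies in both directions.\<close>

lemma Lambda_sigma_stable: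
  fixes e :: "nat \<Rightarrow> 'n::finite"
  assumes e: "bij_betw e {..<CARD('n)} UNIV" and u: "u \<in> Lambda_set e" and z: "same_signs e u z"
  shows "z \<in> Lambda_set e" "sigma e z = sigma e u"
proof -
  have u0: "u \<noteq> 0" using Lambda_set_nonzero[OF u] .
  have F: "follows_nearest (int CARD('n)) (padded e u) (padded e z)" if "same_signs e u z" for z
    by (rule alternating_follows_nearest)
       (use that u padded_outside[of _ e u] in \<open>auto simp: Lambda_set_alternating same_signs_def\<close>)
  have s: "same_signs e u u" by (simp add: same_signs_def zero_less_mult_iff) linarith
  show "z \<in> Lambda_set e" by (rule follows_nearest_Lambda[OF e u0 F[OF z]])
  show "sigma e z = sigma e u"
    using follows_nearest_Lambda(2)[OF e u0 F[OF z] s] follows_nearest_Lambda(2)[OF e u0 F[OF s] z] by simp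
qed

lemma eventually_Lambda_sigma:
  fixes e :: "nat \<Rightarrow> 'n::finite"
  assumes "bij_betw e {..<CARD('n)} UNIV" "u \<in> Lambda_set e"
  shows "\<forall>\<^sub>F z in nhds u. z \<in> Lambda_set e \<and> sigma e z = sigma e u"
  using eventually_same_signs[of e u] by eventually_elim (use Lambda_sigma_stable[OF assms] in blast)

lemma padded_scaleR: "padded e (c *\<^sub>R x) i = c * padded e x i"
  by (simp add: padded_def)

lemma Lambda_set_scaleR:
  fixes e :: "nat \<Rightarrow> 'n::finite"
  assumes "c \<noteq> 0"
  shows "c *\<^sub>R x \<in> Lambda_set e \<longleftrightarrow> x \<in> Lambda_set e" "sigma e (c *\<^sub>R x) = sigma e x"
proof -
  have "c * a * (c * b) < 0 \<longleftrightarrow> a * b < 0" for a b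
    using assms by (simp add: mult_less_0_iff zero_less_mult_iff) (metis linorder_neqE_linordered_idom not_less_iff_gr_or_eq)
  then show "c *\<^sub>R x \<in> Lambda_set e \<longleftrightarrow> x \<in> Lambda_set e" "sigma e (c *\<^sub>R x) = sigma e x"
    using assms by (auto simp: Lambda_set_def sigma_def coord_def)
qed

section \<open>Jacobi systems: the number of sign changes along a solution\<close>

locale jacobi_flow = linear_flow Y flow B Phi
  for Y :: "'y::metric_space set" and flow and B :: "'y \<Rightarrow> real^'n::finite^'n" and Phi +
  fixes e :: "nat \<Rightarrow> 'n"
  assumes enum: "bij_betw e {..<CARD('n)} UNIV"
    and B_tridiag: "\<And>y i j. y \<in> Y \<Longrightarrow> i < CARD('n) \<Longrightarrow> j < CARD('n) \<Longrightarrow>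
                      j + 1 < i \<or> i + 1 < j \<Longrightarrow> B y $ e i $ e j = 0"
    and B_super: "\<And>y i. y \<in> Y \<Longrightarrow> i + 1 < CARD('n) \<Longrightarrow> B y $ e i $ e (i + 1) > 0"
    and B_sub: "\<And>y i. y \<in> Y \<Longrightarrow> i + 1 < CARD('n) \<Longrightarrow> B y $ e (i + 1) $ e i > 0"
begin

lemma padded_mult:
  fixes v :: "real^'n"
  assumes y: "y \<in> Y" and i: "0 \<le> i" "i < int CARD('n)"
  defines "h \<equiv> (\<lambda>k. (if 0 \<le> k \<and> k < int CARD('n) then B y $ e (nat i) $ e (nat k) else 1) * padded e v k)"
  shows "padded e (B y *v v) i = h (i - 1) + h i + h (i + 1)"
proof -
  have "padded e (B y *v v) i = (\<Sum>j\<in>UNIV. B y $ e (nat i) $ j * v $ j)"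
    using i by (simp add: padded_def matrix_vector_mult_def)
  also have "\<dots> = (\<Sum>k<CARD('n). B y $ e (nat i) $ e k * v $ e k)"
    by (rule sum.reindex_bij_betw[OF enum, symmetric])
  also have "\<dots> = (\<Sum>k<CARD('n). h (int k))"
    by (rule sum.cong) (auto simp: h_def padded_def)
  also have "\<dots> = sum h {0..<int CARD('n)}"
    by (rule sum.reindex_bij_witness[of _ nat int]) auto
  also have "\<dots> = sum h {i - 1, i, i + 1}"
  \<comment> \<open>Indices in range but away from i drop out by tridiagonality, and neighbours of i
    outside the range by the zero padding.\<close>
  proof (rule sum.mono_neutral_cong)
    fix k assume k: "k \<in> {0..<int CARD('n)} - {i - 1, i, i + 1}"
    then have "nat k + 1 < nat i \<or> nat i + 1 < nat k" using i by auto
    then have "B y $ e (nat i) $ e (nat k) = 0" using k i by (intro B_tridiag y) auto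
    then show "h k = 0" using k by (simp add: h_def)
  next
    fix k assume "k \<in> {i - 1, i, i + 1} - {0..<int CARD('n)}"
    then show "h k = 0" by (auto simp: h_def padded_def)
  qed auto
  also have "\<dots> = h (i - 1) + h i + h (i + 1)" by simp
  finally show ?thesis .
qed

lemma solution_follows_nearest:
  assumes y: "y \<in> Y"
  shows "\<forall>\<^sub>F t in at_right t0. follows_nearest (int CARD('n)) (padded e (Phi t0 y *v x)) (padded e (Phi t y *v x))"
proof -
  \<comment> \<open>The default 1 keeps every off-diagonal coefficient positive and continuous at
    all integer indices; in the equations it only multiplies padding zeros.\<close>
  define q where "q i k t = (if 0 \<le> i \<and> i < int CARD('n) \<and> 0 \<le> k \<and> k < int CARD('n)
     then B (flow y t) $ e (nat i) $ e (nat k) else 1)" for i k :: int and t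
  have flow_y: "continuous_on UNIV (\<lambda>t. flow y t)"
  proof -
    have "continuous_on UNIV ((\<lambda>(y, t). flow y t) \<circ> (\<lambda>t. (y, t)))"
      by (intro continuous_on_compose continuous_intros continuous_on_subset[OF flow_cont]) (use y in auto)
    then show ?thesis by (simp add: o_def)
  qed
  have "continuous_on UNIV (B \<circ> (\<lambda>t. flow y t))"
    by (intro continuous_on_compose flow_y continuous_on_subset[OF B_cont]) (use flow_in y in auto)
  then have cB: "isCont (\<lambda>t. B (flow y t)) t0" by (simp add: o_def continuous_on_eq_continuous_at)
  have qc: "isCont (\<lambda>t. q i k t) t0" for i k
    using cB by (cases "0 \<le> i \<and> i < int CARD('n) \<and> 0 \<le> k \<and> k < int CARD('n)") (auto simp: q_def intro!: continuous_intros)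
  have pos: "0 < q i (i - 1) t0" "0 < q i (i + 1) t0" for i
  proof -
    show "0 < q i (i - 1) t0"
    proof (cases "0 < i \<and> i < int CARD('n)")
      case True
      then have "nat i = nat (i - 1) + 1" by auto
      then show ?thesis using True B_sub[OF flow_in[OF y], of "nat (i - 1)" t0] by (auto simp: q_def)
    qed (auto simp: q_def)
    show "0 < q i (i + 1) t0"
    proof (cases "0 \<le> i \<and> i + 1 < int CARD('n)")
      case True
      then have "nat (i + 1) = nat i + 1" by auto
      then show ?thesis using True B_super[OF flow_in[OF y], of "nat i" t0] by (auto simp: q_def)
    qed (auto simp: q_def)
  qed
  show ?thesis
  proof (rule jacobi_follows_nearest[where X = "\<lambda>i t. padded e (Phi t y *v x) i"
        and a = "\<lambda>i. q i (i - 1)" and b = "\<lambda>i. q i i" and c = "\<lambda>i. q i (i + 1)"])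
    fix i t assume i: "0 \<le> i" "i < int CARD('n)"
    have "((\<lambda>t. (Phi t y *v x) $ e (nat i)) has_vector_derivative (B (flow y t) *v (Phi t y *v x)) $ e (nat i)) (at t)"
      by (rule bounded_linear.has_vector_derivative[OF bounded_linear_vec_nth solution_deriv[OF y]])
    then have "((\<lambda>t. padded e (Phi t y *v x) i) has_real_derivative padded e (B (flow y t) *v (Phi t y *v x)) i) (at t)"
      using i by (simp add: padded_def has_real_derivative_iff_has_vector_derivative)
    then show "((\<lambda>t. padded e (Phi t y *v x) i) has_real_derivative
        q i (i - 1) t * padded e (Phi t y *v x) (i - 1) + q i i t * padded e (Phi t y *v x) i +
        q i (i + 1) t * padded e (Phi t y *v x) (i + 1)) (at t)"
      unfolding padded_mult[OF flow_in[OF y] i] using i by (simp add: q_def)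
  qed (use qc pos padded_outside[of _ e] in auto)
qed

lemma solution_right_nbhd:
  assumes y: "y \<in> Y" and x: "x \<noteq> 0"
  shows "\<forall>\<^sub>F t in at_right t0. Phi t y *v x \<in> Lambda_set e \<and>
     (\<forall>z. same_signs e (Phi t0 y *v x) z \<longrightarrow> sigma e (Phi t y *v x) \<le> sigma e z)"
  using solution_follows_nearest[OF y, of t0 x]
  by eventually_elim (use follows_nearest_Lambda[OF enum solution_nonzero[OF y x]] in blast)

lemma Lambda_times_dense:
  assumes y: "y \<in> Y" and x: "x \<noteq> 0" and "s < t"
  obtains r where "s < r" "r < t" "Phi r y *v x \<in> Lambda_set e"
proof -
  obtain b where b: "b > s" "\<And>r. s < r \<Longrightarrow> r < b \<Longrightarrow> Phi r y *v x \<in> Lambda_set e"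
    using solution_right_nbhd[OF y x, of s] unfolding eventually_at_right_field by blast
  obtain r where "s < r" "r < min b t" using dense[of s "min b t"] b \<open>s < t\<close> by auto
  then show ?thesis using that b by auto
qed

text \<open>At the infimum T of the times with too large a count the solution may lie outside
  \<open>Lambda_set\<close>, where the count means nothing. So T is bridged: a vector z with the
  signs of the solution at T, taken from T's left (or at s), bounds the counts immediately to the
  right of T, and no such time can exist there.\<close>

lemma sigma_nonincreasing:
  assumes y: "y \<in> Y" and L: "Phi s y *v x \<in> Lambda_set e" "Phi t y *v x \<in> Lambda_set e" and "s \<le> t"
  shows "sigma e (Phi t y *v x) \<le> sigma e (Phi s y *v x)"
proof (rule ccontr)
  assume contr: "\<not> ?thesis"
  have x: "x \<noteq> 0" using Lambda_set_nonzero[OF L(1)] by auto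
  let ?N = "sigma e (Phi s y *v x)"
  let ?bad = "{r. s \<le> r \<and> Phi r y *v x \<in> Lambda_set e \<and> ?N < sigma e (Phi r y *v x)}"
  have tbad: "t \<in> ?bad" using contr L \<open>s \<le> t\<close> by auto
  have bdd: "bdd_below ?bad" by (auto intro: bdd_belowI)
  define T where "T = Inf ?bad"
  have sT: "s \<le> T" unfolding T_def using tbad by (intro cInf_greatest) auto
  have before: "r \<notin> ?bad" if "r < T" for r
    using that cInf_lower[OF _ bdd, of r] unfolding T_def by (auto simp: not_le)
  have near: "\<forall>\<^sub>F r in at T. same_signs e (Phi T y *v x) (Phi r y *v x)"
    using eventually_compose_filterlim[OF eventually_same_signs solution_cont[OF y, unfolded isCont_def]] .
  \<comment> \<open>For s < T the witness is the solution at a Lambda-time just before T; for s = T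
    it is the solution at s.\<close>
  have "\<exists>z. same_signs e (Phi T y *v x) z \<and> sigma e z \<le> ?N"
  proof (cases "s = T")
    case True
    then show ?thesis
      by (intro exI[of _ "Phi s y *v x"]) (auto simp: same_signs_def zero_less_mult_iff not_less le_less)
  next
    case False
    then have "s < T" using sT by simp
    have "\<forall>\<^sub>F r in at_left T. same_signs e (Phi T y *v x) (Phi r y *v x)"
      using near by (simp add: eventually_at_split)
    then obtain b where b: "b < T" "\<And>r. b < r \<Longrightarrow> r < T \<Longrightarrow> same_signs e (Phi T y *v x) (Phi r y *v x)"
      unfolding eventually_at_left_field by blast
    obtain r where r: "max b s < r" "r < T" "Phi r y *v x \<in> Lambda_set e"
      using Lambda_times_dense[OF y x, of "max b s" T] b \<open>s < T\<close> by auto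
    then show ?thesis using b(2)[of r] before[of r] by (intro exI[of _ "Phi r y *v x"]) auto
  qed
  then obtain z where z: "same_signs e (Phi T y *v x) z" "sigma e z \<le> ?N" by blast
  have "\<forall>\<^sub>F r in at_right T. sigma e (Phi r y *v x) \<le> ?N"
    using solution_right_nbhd[OF y x, of T] by eventually_elim (use z in \<open>auto intro: order_trans\<close>)
  then obtain b where b: "T < b" "\<And>r. T < r \<Longrightarrow> r < b \<Longrightarrow> sigma e (Phi r y *v x) \<le> ?N"
    unfolding eventually_at_right_field by blast
  \<comment> \<open>If the solution lies in \<open>Lambda_set\<close> at T, its count equals that of
    z.\<close>
  have TN: "T \<notin> ?bad"
    using Lambda_sigma_stable(2)[OF enum _ z(1)] z(2) by auto
  have "b \<le> T" unfolding T_def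
  proof (rule cInf_greatest)
    fix r assume r: "r \<in> ?bad"
    then have "T \<le> r" "r \<noteq> T" using before TN by (auto simp: not_le[symmetric])
    then show "b \<le> r" using b(2)[of r] r by force
  qed (use tbad in auto)
  then show False using b by simp
qed

end

section \<open>The invariant cone\<close>

context linear_flow
begin

text \<open>The lower bound is the upper bound for the inverse, which is the solution map back from
  \<open>flow y t\<close>.\<close>

lemma two_sided_growth_bound:
  obtains M where "0 < M"
    "\<And>y x t. y \<in> Y \<Longrightarrow> norm (Phi t y *v x) \<le> exp (M * \<bar>t\<bar>) * norm x"
    "\<And>y x t. y \<in> Y \<Longrightarrow> norm x \<le> exp (M * \<bar>t\<bar>) * norm (Phi t y *v x)"
proof -
  interpret R: linear_flow Y "\<lambda>y t. flow y (- t)" "\<lambda>y. - B y" "\<lambda>t. Phi (- t)" by (rule reverse)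
  obtain M1 where M1: "0 < M1" "\<And>y x t. y \<in> Y \<Longrightarrow> 0 \<le> t \<Longrightarrow> norm (Phi t y *v x) \<le> exp (M1 * t) * norm x"
    using growth_bound by blast
  obtain M2 where M2: "0 < M2" "\<And>y x t. y \<in> Y \<Longrightarrow> 0 \<le> t \<Longrightarrow> norm (Phi (- t) y *v x) \<le> exp (M2 * t) * norm x"
    using R.growth_bound by blast
  have b: "norm (Phi t y *v x) \<le> exp (max M1 M2 * \<bar>t\<bar>) * norm x" if y: "y \<in> Y" for y x t
  proof (cases "0 \<le> t")
    case True
    have "exp (M1 * t) * norm x \<le> exp (max M1 M2 * \<bar>t\<bar>) * norm x"
      using True by (auto intro!: mult_right_mono)
    then show ?thesis using M1(2)[OF y True, of x] by linarith
  next
    case False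
    have "exp (M2 * - t) * norm x \<le> exp (max M1 M2 * \<bar>t\<bar>) * norm x"
      using False by (intro mult_right_mono iffD2[OF exp_le_cancel_iff] mult_mono) (use M1 in auto)
    then show ?thesis using M2(2)[OF y, of "- t" x] False by simp
  qed
  show ?thesis
  proof (rule that[of "max M1 M2"])
    fix y x t assume y: "y \<in> Y"
    show "norm x \<le> exp (max M1 M2 * \<bar>t\<bar>) * norm (Phi t y *v x)"
      using b[OF flow_in[OF y], of "- t" t "Phi t y *v x"] by (simp add: solution_inverse y)
  qed (use M1 b in auto)
qed

end

text \<open>The closure makes the unit vectors of the cone a compact set and also admits values of
  solutions outside \<open>Lambda_set\<close>. It contains negatives along with its vectors, and
  this symmetry is used below.\<close>

definition low_cone :: "(nat \<Rightarrow> 'n::finite) \<Rightarrow> nat \<Rightarrow> (real^'n) set" where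
  "low_cone e m = closure {x \<in> Lambda_set e. sigma e x \<le> m}"

lemma low_cone_scaleR:
  assumes "c \<noteq> 0" "x \<in> low_cone e m"
  shows "c *\<^sub>R x \<in> low_cone e m"
proof -
  let ?A = "{x \<in> Lambda_set e. sigma e x \<le> m}"
  have "(\<lambda>x. c *\<^sub>R x) ` ?A \<subseteq> ?A" by (auto simp: Lambda_set_scaleR assms(1))
  moreover have "c *\<^sub>R x \<in> closure ((\<lambda>x. c *\<^sub>R x) ` ?A)"
    using assms(2) closure_scaleR[of c ?A] unfolding low_cone_def by blast
  ultimately show ?thesis unfolding low_cone_def using closure_mono by blast
qed

lemma interior_low_cone_scaleR:
  assumes "c \<noteq> 0" "x \<in> interior (low_cone e m)"
  shows "c *\<^sub>R x \<in> interior (low_cone e m)"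
proof (rule interiorI)
  let ?S = "(\<lambda>z. inverse c *\<^sub>R z) -` interior (low_cone e m)"
  show "open ?S" by (intro open_vimage continuous_intros) auto
  show "c *\<^sub>R x \<in> ?S" using assms by simp
  show "?S \<subseteq> low_cone e m"
  proof
    fix z assume "z \<in> ?S"
    then have "inverse c *\<^sub>R z \<in> low_cone e m" using interior_subset by blast
    from low_cone_scaleR[OF assms(1) this] show "z \<in> low_cone e m" using assms(1) by simp
  qed
qed

lemma ball_scaleR_low_cone:
  assumes c: "0 < c"
  shows "ball x d \<subseteq> low_cone e m \<Longrightarrow> ball (c *\<^sub>R x) (c * d) \<subseteq> low_cone e m"
    and "ball x d \<inter> low_cone e m = {} \<Longrightarrow> ball (c *\<^sub>R x) (c * d) \<inter> low_cone e m = {}"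
proof -
  have b: "inverse c *\<^sub>R z \<in> ball x d" if "z \<in> ball (c *\<^sub>R x) (c * d)" for z
  proof -
    have "c * dist x (inverse c *\<^sub>R z) = dist (c *\<^sub>R x) (c *\<^sub>R (inverse c *\<^sub>R z))"
      unfolding dist_norm scaleR_diff_right[symmetric] norm_scaleR using c by simp
    then have "c * dist x (inverse c *\<^sub>R z) < c * d" using that c by simp
    then show ?thesis using c by (simp only: mem_ball mult_less_cancel_left_pos)
  qed
  have s: "z \<in> low_cone e m \<longleftrightarrow> inverse c *\<^sub>R z \<in> low_cone e m" for z
    using low_cone_scaleR[of "inverse c" z e m] low_cone_scaleR[of c "inverse c *\<^sub>R z" e m] c by auto
  show "ball x d \<subseteq> low_cone e m \<Longrightarrow> ball (c *\<^sub>R x) (c * d) \<subseteq> low_cone e m"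
    using b s by blast
  show "ball x d \<inter> low_cone e m = {} \<Longrightarrow> ball (c *\<^sub>R x) (c * d) \<inter> low_cone e m = {}"
    using b s by blast
qed

section \<open>Strict invariance of the cone and the separation estimate\<close>

context jacobi_flow
begin

text \<open>Since \<open>sigma\<close> is locally constant on \<open>Lambda_set\<close>, taking the
  closure adds no vector of \<open>Lambda_set\<close> with a larger count.\<close>

lemma low_cone_Lambda:
  assumes x: "x \<in> low_cone e m" "x \<in> Lambda_set e"
  shows "sigma e x \<le> m"
proof -
  obtain d where d: "d > 0" "\<And>z. dist z x < d \<Longrightarrow> sigma e z = sigma e x"
    using eventually_Lambda_sigma[OF enum x(2)] unfolding eventually_nhds_metric by blast
  obtain z where "sigma e z \<le> m" "dist z x < d"
    using x(1) d(1) unfolding low_cone_def closure_approachable by blast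
  then show ?thesis using d(2) by simp
qed

text \<open>The value at t is the limit of values at Lambda-times shortly after t, so only later
  times need control.\<close>

lemma in_low_coneI:
  assumes y: "y \<in> Y" and x: "x \<noteq> 0"
    and s: "\<And>r. t < r \<Longrightarrow> Phi r y *v x \<in> Lambda_set e \<Longrightarrow> sigma e (Phi r y *v x) \<le> m"
  shows "Phi t y *v x \<in> low_cone e m"
  unfolding low_cone_def closure_approachable
proof (intro allI impI)
  fix \<epsilon> :: real assume "0 < \<epsilon>"
  then obtain d where d: "d > 0" "\<And>r. dist r t < d \<Longrightarrow> dist (Phi r y *v x) (Phi t y *v x) < \<epsilon>"
    using solution_cont[OF y, where t = t and x = x] unfolding continuous_at_eps_delta by blast
  obtain r where "t < r" "r < t + d" "Phi r y *v x \<in> Lambda_set e"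
    using Lambda_times_dense[OF y x, of t "t + d"] d by auto
  then show "\<exists>z\<in>{x \<in> Lambda_set e. sigma e x \<le> m}. dist z (Phi t y *v x) < \<epsilon>"
    using s d(2)[of r] by (intro bexI[of _ "Phi r y *v x"]) (auto simp: dist_real_def)
qed

text \<open>A Lambda-time s strictly between 0 and 1 serves twice: \<open>sigma\<close> is constant
  near the solution at s, which carries the bound m from approximants of w to w itself, and then
  from the solution at s to a whole neighbourhood of the value at time 1.\<close>

lemma low_cone_interior:
  assumes y: "y \<in> Y" and w: "w \<in> low_cone e m" "w \<noteq> 0"
  shows "Phi 1 y *v w \<in> interior (low_cone e m)"
proof -
  obtain s where s: "0 < s" "s < 1" "Phi s y *v w \<in> Lambda_set e"
    using Lambda_times_dense[OF y w(2), of 0 1] by auto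
  have mult_tendsto: "((\<lambda>x. Phi r z *v x) \<longlongrightarrow> Phi r z *v a) (nhds a)" for r z a
    using bounded_linear.tendsto[OF matrix_vector_mul_bounded_linear filterlim_ident] .
  let ?p = "Phi s y *v w"
  have "\<forall>\<^sub>F x in nhds w. sigma e (Phi s y *v x) = sigma e ?p \<and> Phi s y *v x \<in> Lambda_set e"
    using eventually_compose_filterlim[OF eventually_Lambda_sigma[OF enum s(3)] mult_tendsto]
    by eventually_elim auto
  then obtain d where d: "d > 0" "\<And>x. dist x w < d \<Longrightarrow> sigma e (Phi s y *v x) = sigma e ?p \<and> Phi s y *v x \<in> Lambda_set e"
    unfolding eventually_nhds_metric by blast
  \<comment> \<open>The vector w may lie outside \<open>Lambda_set\<close>; an approximant x inside
    has a usable count at time 0 and the same count as w at time s.\<close>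
  obtain x where x: "x \<in> Lambda_set e" "sigma e x \<le> m" "dist x w < d"
    using w(1) d(1) unfolding low_cone_def closure_approachable by blast
  have "sigma e (Phi s y *v x) \<le> sigma e (Phi 0 y *v x)"
    by (rule sigma_nonincreasing[OF y]) (use x d s in \<open>auto simp: Phi_0 y\<close>)
  then have p: "sigma e ?p \<le> m" using x d(2)[of x] by (simp add: Phi_0 y)
  let ?y = "flow y 1" and ?q = "Phi 1 y *v w"
  \<comment> \<open>Points near the value at time 1 are pulled back to time s, where their count is
    at most m; by monotonicity it remains so afterwards, which puts them in the cone.\<close>
  have "Phi (s - 1) ?y *v ?q = ?p" using cocycle[OF y, of "s - 1" 1 w] by simp
  then have "((\<lambda>q. Phi (s - 1) ?y *v q) \<longlongrightarrow> ?p) (nhds ?q)" using mult_tendsto[of "s - 1" ?y ?q] by simp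
  from eventually_compose_filterlim[OF eventually_Lambda_sigma[OF enum s(3)] this]
  have "\<forall>\<^sub>F q in nhds ?q. q \<in> low_cone e m"
  proof eventually_elim
    case (elim q)
    let ?z = "Phi (s - 1) ?y *v q"
    have z: "?z \<in> Lambda_set e" "sigma e ?z \<le> m" using elim p by auto
    have "Phi (1 - s) (flow y s) *v ?z \<in> low_cone e m"
    proof (rule in_low_coneI[OF flow_in[OF y] Lambda_set_nonzero[OF z(1)]])
      fix r assume r: "1 - s < r" "Phi r (flow y s) *v ?z \<in> Lambda_set e"
      have "sigma e (Phi r (flow y s) *v ?z) \<le> sigma e (Phi 0 (flow y s) *v ?z)"
        by (rule sigma_nonincreasing[OF flow_in[OF y]]) (use r z s in \<open>auto simp: Phi_0 flow_in y\<close>)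
      then show "sigma e (Phi r (flow y s) *v ?z) \<le> m" using z by (simp add: Phi_0 flow_in y)
    qed
    moreover have "Phi (1 - s) (flow y s) *v ?z = q"
      using cocycle[OF flow_in[OF y], of "1 - s" 1 "s - 1" q] by (simp add: flow_add y Phi_0 flow_in)
    ultimately show ?case by simp
  qed
  then show ?thesis unfolding eventually_nhds by (meson interiorI subsetI)
qed

text \<open>Both margins come from a compact set inside an open one, first on unit vectors and then
  by scaling. The second uses the contrapositive of \<open>low_cone_interior\<close>: pulling back
  by one unit of time takes vectors outside the interior to vectors outside the cone.\<close>

lemma uniform_cone_gap:
  obtains \<delta> where "0 < \<delta>"
    "\<And>y w. y \<in> Y \<Longrightarrow> w \<in> low_cone e m \<Longrightarrow> w \<noteq> 0 \<Longrightarrow> ball (Phi 1 y *v w) (\<delta> * norm w) \<subseteq> low_cone e m"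
    "\<And>y v. y \<in> Y \<Longrightarrow> v \<noteq> 0 \<Longrightarrow> Phi 1 y *v v \<notin> interior (low_cone e m) \<Longrightarrow>
        ball v (\<delta> * norm v) \<inter> low_cone e m = {}"
proof -
  interpret R: linear_flow Y "\<lambda>y t. flow y (- t)" "\<lambda>y. - B y" "\<lambda>t. Phi (- t)" by (rule reverse)
  let ?D = "low_cone e m"
  have clD: "closed ?D" by (simp add: low_cone_def)
  obtain M where M: "0 < M" "\<And>y x t. y \<in> Y \<Longrightarrow> norm x \<le> exp (M * \<bar>t\<bar>) * norm (Phi t y *v x)"
    using two_sided_growth_bound by metis
  let ?K1 = "(\<lambda>(y, x). Phi 1 y *v x) ` (Y \<times> (?D \<inter> sphere 0 1))"
  have K1: "compact ?K1"
    by (intro compact_continuous_image continuous_on_subset[OF time_one_cont] compact_Times Y_compact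
        closed_Int_compact clD) auto
  have "?K1 \<subseteq> interior ?D" using low_cone_interior by (force simp: sphere_def)
  from compact_subset_open_imp_ball_epsilon_subset[OF K1 open_interior this]
  obtain d1 where d1: "d1 > 0" "(\<Union>x\<in>?K1. ball x d1) \<subseteq> interior ?D" by blast
  let ?K2 = "(\<lambda>(y, x). Phi (- 1) y *v x) ` (Y \<times> (sphere 0 1 - interior ?D))"
  have K2: "compact ?K2"
    by (intro compact_continuous_image continuous_on_subset[OF R.time_one_cont] compact_Times Y_compact
        compact_diff) auto
  have "?K2 \<subseteq> - ?D"
  proof clarsimp
    fix y x assume y: "y \<in> Y" and x: "norm x = 1" "x \<notin> interior ?D" and D: "Phi (- 1) y *v x \<in> ?D"
    have "Phi 1 (flow y (- 1)) *v (Phi (- 1) y *v x) \<in> interior ?D"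
      by (rule low_cone_interior[OF flow_in[OF y] D solution_nonzero[OF y]]) (use x in auto)
    then show False using x cocycle[OF y, of 1 "- 1" x] by (simp add: Phi_0 y)
  qed
  from compact_subset_open_imp_ball_epsilon_subset[OF K2 open_Compl[OF clD] this]
  obtain d2 where d2: "d2 > 0" "(\<Union>x\<in>?K2. ball x d2) \<subseteq> - ?D" by blast
  \<comment> \<open>The second margin is measured relative to the vector at time 1; expressing it
    relative to v costs the growth factor exp M.\<close>
  define \<delta> where "\<delta> = min d1 (d2 / exp M)"
  show ?thesis
  proof (rule that)
    show "0 < \<delta>" using d1 d2 by (simp add: \<delta>_def)
    fix y assume y: "y \<in> Y"
    show "ball (Phi 1 y *v w) (\<delta> * norm w) \<subseteq> ?D" if w: "w \<in> ?D" "w \<noteq> 0" for w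
    proof -
      let ?w = "inverse (norm w) *\<^sub>R w"
      have "?w \<in> ?D \<inter> sphere 0 1" using w by (auto intro!: low_cone_scaleR)
      then have "ball (Phi 1 y *v ?w) d1 \<subseteq> interior ?D" using d1(2) y by blast
      then have "ball (Phi 1 y *v ?w) d1 \<subseteq> ?D" using interior_subset by blast
      then have "ball (norm w *\<^sub>R (Phi 1 y *v ?w)) (norm w * d1) \<subseteq> ?D"
        using w by (intro ball_scaleR_low_cone) auto
      moreover have "norm w *\<^sub>R (Phi 1 y *v ?w) = Phi 1 y *v w" using w by (simp add: matrix_vector_mult_scaleR)
      moreover have "\<delta> * norm w \<le> norm w * d1"
        by (subst mult.commute, rule mult_left_mono) (auto simp: \<delta>_def)
      ultimately show ?thesis using subset_ball by fastforce
    qed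
    show "ball v (\<delta> * norm v) \<inter> ?D = {}" if v: "v \<noteq> 0" "Phi 1 y *v v \<notin> interior ?D" for v
    proof -
      let ?w = "Phi 1 y *v v"
      have w0: "?w \<noteq> 0" using solution_nonzero[OF y v(1)] .
      have "inverse (norm ?w) *\<^sub>R ?w \<notin> interior ?D"
        using interior_low_cone_scaleR[of "norm ?w" "inverse (norm ?w) *\<^sub>R ?w" e m] v w0 by auto
      then have "(flow y 1, inverse (norm ?w) *\<^sub>R ?w) \<in> Y \<times> (sphere 0 1 - interior ?D)"
        using flow_in[OF y] w0 by simp
      then have "ball (Phi (- 1) (flow y 1) *v (inverse (norm ?w) *\<^sub>R ?w)) d2 \<inter> ?D = {}" using d2(2) by blast
      moreover have "Phi (- 1) (flow y 1) *v (inverse (norm ?w) *\<^sub>R ?w) = inverse (norm ?w) *\<^sub>R v"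
        using solution_inverse[OF y, of 1 v] by (simp add: matrix_vector_mult_scaleR)
      ultimately have "ball (norm ?w *\<^sub>R (inverse (norm ?w) *\<^sub>R v)) (norm ?w * d2) \<inter> ?D = {}"
        using w0 by (intro ball_scaleR_low_cone) auto
      then have "ball v (norm ?w * d2) \<inter> ?D = {}" using w0 by simp
      moreover have "\<delta> * norm v \<le> norm ?w * d2"
      proof -
        have "\<delta> * norm v \<le> d2 / exp M * norm v" by (rule mult_right_mono) (auto simp: \<delta>_def)
        also have "\<dots> \<le> d2 / exp M * (exp M * norm ?w)"
          using M(2)[OF y, of v 1] d2 by (intro mult_left_mono) auto
        finally show ?thesis by (simp add: mult.commute)
      qed
      ultimately show ?thesis using subset_ball by fastforce
    qed
  qed
qed

lemma exponential_separation:
  obtains K \<nu> where "0 < K" "0 < \<nu>"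
    "\<And>y x1 x2 t. y \<in> Y \<Longrightarrow> x1 \<in> W e Phi 0 m y \<Longrightarrow> x2 \<in> W e Phi (Suc m) l y \<Longrightarrow>
       norm x1 = 1 \<Longrightarrow> norm x2 = 1 \<Longrightarrow> 0 \<le> t \<Longrightarrow>
       norm (Phi t y *v x2) / norm (Phi t y *v x1) \<le> K * exp (- \<nu> * t)"
proof -
  let ?D = "low_cone e m"
  obtain M where M: "0 < M" "\<And>y x t. y \<in> Y \<Longrightarrow> norm (Phi t y *v x) \<le> exp (M * \<bar>t\<bar>) * norm x"
    "\<And>y x t. y \<in> Y \<Longrightarrow> norm x \<le> exp (M * \<bar>t\<bar>) * norm (Phi t y *v x)"
    using two_sided_growth_bound by metis
  obtain \<delta> where \<delta>: "0 < \<delta>"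
    and cone: "\<And>y w. y \<in> Y \<Longrightarrow> w \<in> ?D \<Longrightarrow> w \<noteq> 0 \<Longrightarrow> ball (Phi 1 y *v w) (\<delta> * norm w) \<subseteq> ?D"
    and anticone: "\<And>y v. y \<in> Y \<Longrightarrow> v \<noteq> 0 \<Longrightarrow> Phi 1 y *v v \<notin> interior ?D \<Longrightarrow> ball v (\<delta> * norm v) \<inter> ?D = {}"
    using uniform_cone_gap by metis
  \<comment> \<open>One factor \<delta> is the margin of the cone, the other comes from |u + c v|
    being at least c \<delta> |v|; exp M bounds the growth of v in unit time, and the 2 makes the
    inequality strict for the open ball.\<close>
  define \<eta> where "\<eta> = \<delta>\<^sup>2 / (2 * exp M)"
  have \<eta>: "0 < \<eta>" using \<delta> by (simp add: \<eta>_def)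
  have step: "Phi 1 y *v u + (c * (1 + \<eta>)) *\<^sub>R (Phi 1 y *v v) \<in> ?D"
    if y: "y \<in> Y" and u: "u \<in> ?D" and v: "v \<noteq> 0" "Phi 1 y *v v \<notin> interior ?D"
      and c: "0 < c" and uc: "u + c *\<^sub>R v \<in> ?D" for y u v c
  proof -
    let ?w = "u + c *\<^sub>R v"
    \<comment> \<open>The distance from v to -u / c is |u + c v| / c, so the margin of v bounds |u +
      c v| from below.\<close>
    have "- inverse c *\<^sub>R u \<in> ?D" using low_cone_scaleR[OF _ u, of "- inverse c"] c by simp
    then have "\<delta> * norm v \<le> dist v (- inverse c *\<^sub>R u)" using anticone[OF y v] by (auto simp: not_less[symmetric])
    then have "c * (\<delta> * norm v) \<le> c * dist v (- inverse c *\<^sub>R u)" using c by simp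
    also have "\<dots> = norm (c *\<^sub>R (v - (- inverse c *\<^sub>R u)))" using c by (simp add: dist_norm)
    also have "c *\<^sub>R (v - (- inverse c *\<^sub>R u)) = ?w" using c by (simp add: algebra_simps)
    finally have nw: "c * (\<delta> * norm v) \<le> norm ?w" .
    moreover have "0 < c * (\<delta> * norm v)" using c \<delta> v by simp
    ultimately have w0: "?w \<noteq> 0" by auto
    have "norm ((c * \<eta>) *\<^sub>R (Phi 1 y *v v)) \<le> c * \<eta> * (exp M * norm v)"
      using M(2)[OF y, of 1 v] c \<eta> by (simp add: mult_left_mono)
    also have "\<dots> = \<delta> * (c * (\<delta> * norm v)) / 2" by (simp add: \<eta>_def power2_eq_square)
    also have "\<dots> < \<delta> * (c * (\<delta> * norm v))" using c \<delta> v by simp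
    also have "\<dots> \<le> \<delta> * norm ?w" using nw \<delta> by (intro mult_left_mono) auto
    finally have "Phi 1 y *v ?w + (c * \<eta>) *\<^sub>R (Phi 1 y *v v) \<in> ball (Phi 1 y *v ?w) (\<delta> * norm ?w)"
      by (simp add: dist_norm)
    then have "Phi 1 y *v ?w + (c * \<eta>) *\<^sub>R (Phi 1 y *v v) \<in> ?D" using cone[OF y uc w0] by blast
    then show ?thesis by (simp add: algebra_simps matrix_vector_mult_scaleR)
  qed
  \<comment> \<open>Half the radius \<delta> / exp M of a ball around x1 that is guaranteed to lie
    in the cone.\<close>
  define c0 where "c0 = \<delta> / (2 * exp M)"
  have c0: "0 < c0" using \<delta> by (simp add: c0_def)
  define \<nu> where "\<nu> = ln (1 + \<eta>)"
  have \<nu>: "0 < \<nu>" using \<eta> by (simp add: \<nu>_def)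
  \<comment> \<open>The two factors exp M compare the norms at t with those at the last integer
    time, and exp \<nu> pays for rounding t down.\<close>
  define K where "K = exp M * exp M * exp \<nu> / (\<delta> * c0)"
  show ?thesis
  proof (rule that)
    show "0 < K" using \<delta> c0 by (simp add: K_def)
    show "0 < \<nu>" by (rule \<nu>)
    fix y x1 x2 and t :: real
    assume y: "y \<in> Y" and x1: "x1 \<in> W e Phi 0 m y" and x2: "x2 \<in> W e Phi (Suc m) l y"
      and n: "norm x1 = 1" "norm x2 = 1" and t: "0 \<le> t"
    have nz: "x1 \<noteq> 0" "x2 \<noteq> 0" using n by auto
    \<comment> \<open>Negative r is included, because \<open>W\<close> constrains the whole
      orbit.\<close>
    have D1: "Phi r y *v x1 \<in> ?D" for r
      by (rule in_low_coneI[OF y nz(1)]) (use x1 nz in \<open>auto simp: W_def\<close>)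
    \<comment> \<open>A solution in the open interior would stay there until some Lambda-time, and
      its count there would be at most m.\<close>
    have D2: "Phi r y *v x2 \<notin> interior ?D" for r
    proof
      assume "Phi r y *v x2 \<in> interior ?D"
      then have "\<forall>\<^sub>F s in at r. Phi s y *v x2 \<in> interior ?D"
        using solution_cont[OF y, unfolded isCont_def] by (rule_tac topological_tendstoD) auto
      then have "\<forall>\<^sub>F s in at_right r. Phi s y *v x2 \<in> interior ?D" by (simp add: eventually_at_split)
      then obtain b where b: "r < b" "\<And>s. r < s \<Longrightarrow> s < b \<Longrightarrow> Phi s y *v x2 \<in> interior ?D"
        unfolding eventually_at_right_field by blast
      obtain s where s: "r < s" "s < b" "Phi s y *v x2 \<in> Lambda_set e"
        using Lambda_times_dense[OF y nz(2) b(1)] by blast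
      have "sigma e (Phi s y *v x2) \<le> m"
        using low_cone_Lambda[OF _ s(3)] b(2)[OF s(1,2)] interior_subset by blast
      moreover have "Suc m \<le> sigma e (Phi s y *v x2)" using x2 nz s by (auto simp: W_def)
      ultimately show False by simp
    qed
    have shift: "Phi 1 (flow y r) *v (Phi r y *v x) = Phi (r + 1) y *v x" for r x
      using cocycle[OF y] .
    have iter: "Phi (real k) y *v x1 + (c0 * (1 + \<eta>) ^ k) *\<^sub>R (Phi (real k) y *v x2) \<in> ?D" for k
    proof (induction k)
      case 0
      \<comment> \<open>Starting one unit of time earlier gives x1 itself a ball inside the cone;
        its radius is bounded below because |?z| is at least exp (- M).\<close>
      let ?z = "Phi (- 1) y *v x1"
      have "ball (Phi 1 (flow y (- 1)) *v ?z) (\<delta> * norm ?z) \<subseteq> ?D"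
        by (rule cone[OF flow_in[OF y] D1 solution_nonzero[OF y nz(1)]])
      then have b: "ball x1 (\<delta> * norm ?z) \<subseteq> ?D" using shift[of "-1" x1] by (simp add: Phi_0 y)
      have "norm (c0 *\<^sub>R x2) = \<delta> / (2 * exp M)" using \<delta> n by (simp add: c0_def)
      also have "\<dots> < \<delta> / exp M" using \<delta> by (simp add: field_simps)
      also have "\<dots> \<le> \<delta> * norm ?z"
        using M(3)[OF y, of x1 "- 1"] n \<delta> by (simp add: field_simps)
      finally have "x1 + c0 *\<^sub>R x2 \<in> ball x1 (\<delta> * norm ?z)" by (simp add: dist_norm)
      then show ?case using b by (auto simp: Phi_0 y)
    next
      case (Suc k)
      have "Phi 1 (flow y k) *v (Phi k y *v x1) + (c0 * (1 + \<eta>) ^ k * (1 + \<eta>)) *\<^sub>R (Phi 1 (flow y k) *v (Phi k y *v x2)) \<in> ?D"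
        by (rule step[OF flow_in[OF y] D1 solution_nonzero[OF y nz(2)] _ _ Suc.IH])
           (use D2 shift c0 \<eta> in auto)
      then show ?case by (simp add: shift algebra_simps)
    qed
    define k where "k = nat \<lfloor>t\<rfloor>"
    have k: "real k \<le> t" "t < real k + 1" using t unfolding k_def by linarith+
    let ?U = "Phi (real k) y *v x1" and ?V = "Phi (real k) y *v x2" and ?c = "c0 * (1 + \<eta>) ^ k"
    have c: "0 < ?c" using c0 \<eta> by simp
    have "inverse ?c *\<^sub>R (?U + ?c *\<^sub>R ?V) \<in> ?D"
      by (intro low_cone_scaleR iter) (use c0 \<eta> in auto)
    moreover have "inverse ?c *\<^sub>R (?U + ?c *\<^sub>R ?V) = inverse ?c *\<^sub>R ?U + ?V"
    proof -
      have "inverse ?c * ?c = 1" using c by (intro left_inverse) linarith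
      then show ?thesis by (simp only: scaleR_add_right scaleR_scaleR scaleR_one)
    qed
    \<comment> \<open>This vector of the cone differs from ?V by ?U / ?c, so the margin around ?V
      forces |?U| / ?c to be at least \<delta> |?V|.\<close>
    ultimately have "inverse ?c *\<^sub>R ?U + ?V \<notin> ball ?V (\<delta> * norm ?V)"
      using anticone[OF flow_in[OF y, of "real k"] solution_nonzero[OF y nz(2)], of "real k"] D2 shift by auto
    then have "\<delta> * norm ?V \<le> norm (inverse ?c *\<^sub>R ?U)" by (simp add: dist_norm)
    then have "\<delta> * norm ?V \<le> inverse ?c * norm ?U"
      using abs_of_pos[OF positive_imp_inverse_positive[OF c]] by (simp only: norm_scaleR)
    then have UV: "norm ?V \<le> norm ?U / (\<delta> * ?c)"
      using c0 \<eta> \<delta> by (simp add: field_simps)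
    define r where "r = t - real k"
    have r: "0 \<le> r" "r \<le> 1" "t = real k + r" using k by (auto simp: r_def)
    have er: "exp (M * \<bar>r\<bar>) \<le> exp M" using r M by (simp add: mult_left_le)
    have "norm (Phi t y *v x2) \<le> exp (M * \<bar>r\<bar>) * norm ?V"
      using M(2)[OF flow_in[OF y], of r "real k" ?V] cocycle[OF y, of r "real k" x2] r by simp
    also have "\<dots> \<le> exp M * norm ?V" using er by (intro mult_right_mono) auto
    finally have 1: "norm (Phi t y *v x2) \<le> exp M * norm ?V" .
    have "norm ?U \<le> exp (M * \<bar>r\<bar>) * norm (Phi t y *v x1)"
      using M(3)[OF flow_in[OF y], of ?U r "real k"] cocycle[OF y, of r "real k" x1] r by simp
    also have "\<dots> \<le> exp M * norm (Phi t y *v x1)" using er by (intro mult_right_mono) auto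
    finally have 2: "norm ?U \<le> exp M * norm (Phi t y *v x1)" .
    have p: "0 < norm (Phi t y *v x1)" using solution_nonzero[OF y nz(1)] by simp
    have le: "exp (- \<nu> * real k) \<le> exp (\<nu> + - \<nu> * t)"
    proof -
      have "\<nu> * t \<le> \<nu> * (real k + 1)" using \<nu> k by (intro mult_left_mono) auto
      then show ?thesis by (simp add: algebra_simps)
    qed
    have "norm (Phi t y *v x2) \<le> exp M * (norm ?U / (\<delta> * ?c))"
      using 1 UV by (meson exp_ge_zero mult_left_mono order_trans)
    also have "\<dots> \<le> exp M * (exp M * norm (Phi t y *v x1) / (\<delta> * ?c))"
      using 2 c \<delta> by (intro mult_left_mono divide_right_mono) auto
    finally have "norm (Phi t y *v x2) / norm (Phi t y *v x1) \<le> exp M * exp M / (\<delta> * c0) * inverse ((1 + \<eta>) ^ k)"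
      using p by (simp add: field_simps)
    also have "inverse ((1 + \<eta>) ^ k) = exp (- \<nu> * real k)"
      using \<eta> by (simp add: \<nu>_def exp_minus exp_of_nat2_mult)
    also have "exp M * exp M / (\<delta> * c0) * exp (- \<nu> * real k) \<le> exp M * exp M / (\<delta> * c0) * exp (\<nu> + - \<nu> * t)"
      using le \<delta> c0 by (intro mult_left_mono) auto
    also have "\<dots> = K * exp (- \<nu> * t)"
      unfolding K_def exp_add by simp
    finally show "norm (Phi t y *v x2) / norm (Phi t y *v x1) \<le> K * exp (- \<nu> * t)" .
  qed
qed

end

theorem theorem3p3:
  fixes Y :: "'y::metric_space set"
    and flow :: "'y \<Rightarrow> real \<Rightarrow> 'y"
    and B :: "'y \<Rightarrow> real^'n::finite^'n"
    and Phi :: "real \<Rightarrow> 'y \<Rightarrow> real^'n^'n"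
    and e :: "nat \<Rightarrow> 'n"
    and m :: nat
  assumes enum: "bij_betw e {..<CARD('n)} UNIV"
    and Y_compact: "compact Y"
    and flow_in: "\<And>y t. y \<in> Y \<Longrightarrow> flow y t \<in> Y"
    and flow_cont: "continuous_on (Y \<times> UNIV) (\<lambda>(y, t). flow y t)"
    and flow_0: "\<And>y. y \<in> Y \<Longrightarrow> flow y 0 = y"
    and flow_add: "\<And>y s t. y \<in> Y \<Longrightarrow> flow (flow y s) t = flow y (s + t)"
    and B_cont: "continuous_on Y B"
    and B_tridiag: "\<And>y i j. y \<in> Y \<Longrightarrow> i < CARD('n) \<Longrightarrow> j < CARD('n) \<Longrightarrow>
                      j + 1 < i \<or> i + 1 < j \<Longrightarrow> B y $ e i $ e j = 0"
    and B_super: "\<And>y i. y \<in> Y \<Longrightarrow> i + 1 < CARD('n) \<Longrightarrow> B y $ e i $ e (i + 1) > 0"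
    and B_sub: "\<And>y i. y \<in> Y \<Longrightarrow> i + 1 < CARD('n) \<Longrightarrow> B y $ e (i + 1) $ e i > 0"
    and Phi_0: "\<And>y. y \<in> Y \<Longrightarrow> Phi 0 y = mat 1"
    and Phi_deriv: "\<And>y t. y \<in> Y \<Longrightarrow>
                      ((\<lambda>s. Phi s y) has_vector_derivative (B (flow y t) ** Phi t y)) (at t)"
    and m_le: "m + 2 \<le> CARD('n)"
  shows "\<exists>K>0. \<exists>\<nu>>0. \<forall>y\<in>Y. \<forall>x1\<in>W e Phi 0 m y. \<forall>x2\<in>W e Phi (m + 1) (CARD('n) - 1) y.
           norm x1 = 1 \<longrightarrow> norm x2 = 1 \<longrightarrow>
           (\<forall>t\<ge>0. norm (Phi t y *v x2) / norm (Phi t y *v x1) \<le> K * exp (- \<nu> * t))"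
proof -
  interpret jacobi_flow Y flow B Phi e
    by unfold_locales (fact assms)+
  obtain K \<nu> where "0 < K" "0 < \<nu>"
    "\<And>y x1 x2 t. y \<in> Y \<Longrightarrow> x1 \<in> W e Phi 0 m y \<Longrightarrow> x2 \<in> W e Phi (Suc m) (CARD('n) - 1) y \<Longrightarrow>
       norm x1 = 1 \<Longrightarrow> norm x2 = 1 \<Longrightarrow> 0 \<le> t \<Longrightarrow>
       norm (Phi t y *v x2) / norm (Phi t y *v x1) \<le> K * exp (- \<nu> * t)"
    using exponential_separation[of m "CARD('n) - 1"] by metis
  then show ?thesis unfolding Suc_eq_plus1 by blast
qed

end
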